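(* There exists a universal constant $K>0$ such that the following holds. Let $d\ge1$, $\theta\ge0$ and $T\ge K/\theta$. There is an algorithm which, given one copy each of unknown $d$-dimensional quantum states $\rho_1,\dots,\rho_T$ (i.e., given $\rho_1\otimes\cdots\otimes\rho_T$), distinguishes with probability at least $0.99$ the case $D_{\mathrm{HS}}^2(\rho_{\mathrm{avg}},\frac{I}{d})\le0.99\,\theta$ from the case $D_{\mathrm{HS}}^2(\rho_{\mathrm{avg}},\frac{I}{d})>\theta$, where $\rho_{\mathrm{avg}}=\frac1T\sum_{t=1}^T\rho_t$.
   Context: $D_{\mathrm{HS}}^2(\rho,\sigma)=\mathrm{Tr}[(\rho-\sigma)^2]$ is the squared Hilbert–Schmidt distance. The algorithm may apply any quantum measurement to $\rho_1\otimes\cdots\otimes\rho_T$ (chosen depending on $d,\theta,T$ only) and outputs accept/reject; "distinguishes with probability at least $0.99$" means it accepts with probability at least $0.99$ in the first case and rejects with probability at least $0.99$ in the second case. *)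

theory Defs
  imports Complex_Main
begin

text \<open>Square complex matrices of size n are represented as functions
  nat \<Rightarrow> nat \<Rightarrow> complex; only the entries with indices below n matter.\<close>

definition mat_id :: "nat \<Rightarrow> nat \<Rightarrow> complex" where
  "mat_id i j = (if i = j then 1 else 0)"

definition mat_mult :: "nat \<Rightarrow> (nat \<Rightarrow> nat \<Rightarrow> complex) \<Rightarrow> (nat \<Rightarrow> nat \<Rightarrow> complex) \<Rightarrow> (nat \<Rightarrow> nat \<Rightarrow> complex)" where
  "mat_mult n A B = (\<lambda>i j. \<Sum>k<n. A i k * B k j)"

definition mat_trace :: "nat \<Rightarrow> (nat \<Rightarrow> nat \<Rightarrow> complex) \<Rightarrow> complex" where
  "mat_trace n A = (\<Sum>i<n. A i i)"

definition hermitian :: "nat \<Rightarrow> (nat \<Rightarrow> nat \<Rightarrow> complex) \<Rightarrow> bool" where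
  "hermitian n A \<longleftrightarrow> (\<forall>i<n. \<forall>j<n. A i j = cnj (A j i))"

definition psd :: "nat \<Rightarrow> (nat \<Rightarrow> nat \<Rightarrow> complex) \<Rightarrow> bool" where
  "psd n A \<longleftrightarrow> hermitian n A \<and>
     (\<forall>v :: nat \<Rightarrow> complex. 0 \<le> Re (\<Sum>i<n. \<Sum>j<n. cnj (v i) * A i j * v j))"

definition density :: "nat \<Rightarrow> (nat \<Rightarrow> nat \<Rightarrow> complex) \<Rightarrow> bool" where
  "density d \<rho> \<longleftrightarrow> psd d \<rho> \<and> mat_trace d \<rho> = 1"

text \<open>Tensor product rho_0 (x) ... (x) rho_{T-1}, a d^T x d^T matrix; index i
  encodes the tuple of base-d digits (i div d^t) mod d.\<close>
definition tensor_prod :: "nat \<Rightarrow> nat \<Rightarrow> (nat \<Rightarrow> nat \<Rightarrow> nat \<Rightarrow> complex) \<Rightarrow> (nat \<Rightarrow> nat \<Rightarrow> complex)" where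
  "tensor_prod d T \<rho>s = (\<lambda>i j. \<Prod>t<T. \<rho>s t ((i div d ^ t) mod d) ((j div d ^ t) mod d))"

text \<open>Two-outcome measurement (accept effect M): 0 \<le> M \<le> I.\<close>
definition effect :: "nat \<Rightarrow> (nat \<Rightarrow> nat \<Rightarrow> complex) \<Rightarrow> bool" where
  "effect n M \<longleftrightarrow> psd n M \<and> psd n (\<lambda>i j. mat_id i j - M i j)"

definition accept_prob :: "nat \<Rightarrow> (nat \<Rightarrow> nat \<Rightarrow> complex) \<Rightarrow> (nat \<Rightarrow> nat \<Rightarrow> complex) \<Rightarrow> real" where
  "accept_prob n M \<rho> = Re (mat_trace n (mat_mult n M \<rho>))"

definition hs_dist_sq :: "nat \<Rightarrow> (nat \<Rightarrow> nat \<Rightarrow> complex) \<Rightarrow> (nat \<Rightarrow> nat \<Rightarrow> complex) \<Rightarrow> real" where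
  "hs_dist_sq d \<rho> \<sigma> = Re (mat_trace d (mat_mult d (\<lambda>i j. \<rho> i j - \<sigma> i j) (\<lambda>i j. \<rho> i j - \<sigma> i j)))"

definition rho_avg :: "nat \<Rightarrow> (nat \<Rightarrow> nat \<Rightarrow> nat \<Rightarrow> complex) \<Rightarrow> (nat \<Rightarrow> nat \<Rightarrow> complex)" where
  "rho_avg T \<rho>s = (\<lambda>i j. (\<Sum>t<T. \<rho>s t i j) / of_nat T)"

definition max_mixed :: "nat \<Rightarrow> (nat \<Rightarrow> nat \<Rightarrow> complex)" where
  "max_mixed d = (\<lambda>i j. mat_id i j / of_nat d)"

end

(* Let X = T^-2 sum_{s \<noteq> t} S_{st}, where S_{st} swaps the tensor factors s and t. Its mean in
   rho_1 (x) ... (x) rho_T is Tr rho_avg^2 = D + 1/d up to an error of at most 1/T, where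
   D = Tr (rho_avg - I/d)^2. In the variance, disjoint pairs are uncorrelated and pairs with one
   common index contribute at most (4/T) (Tr rho_avg^3 - (Tr rho_avg^2)^2). The bracket is the variance
   of rho_avg in the state rho_avg, hence at most the mean square
   Tr (rho_avg (rho_avg - I/d)^2) \<le> D. So Var X \<le> 4 D / T + O(1/T^2), and by Chebyshev the spectral
   projection of X onto eigenvalues at most 0.995 theta + 1/d is the required measurement as soon as
   T theta is large. *)
theory Submission
  imports Defs "HOL-Analysis.Topology_Euclidean_Space" "HOL-Analysis.Function_Topology"
    "HOL-Analysis.Convex"
begin

text \<open>The subtraction in the variance bracket is essential: at rho_avg = I/d, the term Tr
  rho_avg^3 alone would leave a variance of order 1 / (T d^2), which for theta of order 1 / T
  exceeds theta^2 once T is large against d^2. As the states differ, the bracket appears only after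
  summation: for a fixed common index t the products of means sum to (sum_s Tr rho_s rho_t)^2, and
  Cauchy-Schwarz over t bounds the sum of these squares from below by its value for identical
  states, so unequal states cost nothing. In the rejection case D is not bounded by a multiple of
  theta; there the variance 4 D / T is compared with the square of a gap that grows linearly in D.
  Chebyshev needs the distribution of the measured eigenvalue, hence the spectral theorem, which
  also supplies the Gram representations behind the positivity arguments. Swaps are expanded into
  terms E_ab at s, E_ba at t with matrix units E_ab, so every expectation factors over the tensor
  positions and depends only on how the two index pairs overlap.\<close>

section \<open>The spectral theorem for Hermitian matrices\<close>

definition cinner :: "nat \<Rightarrow> (nat \<Rightarrow> complex) \<Rightarrow> (nat \<Rightarrow> complex) \<Rightarrow> complex" where
  "cinner n u v = (\<Sum>i<n. cnj (u i) * v i)"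

definition mat_vec :: "nat \<Rightarrow> (nat \<Rightarrow> nat \<Rightarrow> complex) \<Rightarrow> (nat \<Rightarrow> complex) \<Rightarrow> (nat \<Rightarrow> complex)" where
  "mat_vec n A v = (\<lambda>i. \<Sum>j<n. A i j * v j)"

lemma cinner_add_left: "cinner n (\<lambda>i. u i + v i) w = cinner n u w + cinner n v w"
  and cinner_add_right: "cinner n w (\<lambda>i. u i + v i) = cinner n w u + cinner n w v"
  and cinner_diff_left: "cinner n (\<lambda>i. u i - v i) w = cinner n u w - cinner n v w"
  and cinner_diff_right: "cinner n w (\<lambda>i. u i - v i) = cinner n w u - cinner n w v"
  and cinner_scale_left: "cinner n (\<lambda>i. c * u i) w = cnj c * cinner n u w"
  and cinner_scale_right: "cinner n w (\<lambda>i. c * u i) = c * cinner n w u"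
  by (simp_all add: cinner_def algebra_simps sum.distrib sum_subtractf sum_distrib_left)

lemmas cinner_simps = cinner_add_left cinner_add_right cinner_diff_left cinner_diff_right
  cinner_scale_left cinner_scale_right

lemma cinner_commute: "cinner n u v = cnj (cinner n v u)"
  by (simp add: cinner_def mult.commute)

lemma cinner_cong:
  "(\<And>i. i < n \<Longrightarrow> u i = u' i) \<Longrightarrow> (\<And>i. i < n \<Longrightarrow> v i = v' i) \<Longrightarrow> cinner n u v = cinner n u' v'"
  by (simp add: cinner_def)

lemma cinner_self: "cinner n u u = of_real (\<Sum>i<n. (cmod (u i))\<^sup>2)"
  unfolding cinner_def of_real_sum by (intro sum.cong refl) (simp only: complex_norm_square mult.commute)

lemma cinner_self_eq_0: "cinner n u u = 0 \<Longrightarrow> i < n \<Longrightarrow> u i = 0"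
  unfolding cinner_self of_real_eq_0_iff by (subst (asm) sum_nonneg_eq_0_iff) auto

lemma mat_vec_linear:
  "mat_vec n A (\<lambda>i. u i + c * v i) = (\<lambda>i. mat_vec n A u i + c * mat_vec n A v i)"
  by (simp add: mat_vec_def algebra_simps sum.distrib sum_distrib_left)

lemma mat_vec_scale: "mat_vec n A (\<lambda>i. c * v i) = (\<lambda>i. c * mat_vec n A v i)"
  by (simp add: mat_vec_def sum_distrib_left mult.left_commute)

lemma Re_complex_of_real_mult: "Re (complex_of_real a * z) = a * Re z"
  by simp

lemma cinner_mat_vec: "cinner n u (mat_vec n A v) = (\<Sum>i<n. \<Sum>j<n. cnj (u i) * A i j * v j)"
  by (simp add: cinner_def mat_vec_def sum_distrib_left mult.assoc)

lemma hermitian_cinner: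
  assumes "hermitian n A"
  shows "cinner n (mat_vec n A u) v = cinner n u (mat_vec n A v)"
proof -
  have "cinner n (mat_vec n A u) v = (\<Sum>i<n. \<Sum>j<n. cnj (A i j) * cnj (u j) * v i)"
    by (simp add: cinner_def mat_vec_def sum_distrib_right)
  also have "\<dots> = (\<Sum>i<n. \<Sum>j<n. cnj (u j) * A j i * v i)"
  proof -
    have "cnj (A i j) = A j i" if "i < n" "j < n" for i j
      using assms that unfolding hermitian_def by metis
    then show ?thesis by (intro sum.cong refl) (simp add: mult.commute)
  qed
  also have "\<dots> = cinner n u (mat_vec n A v)"
    by (subst sum.swap) (simp add: cinner_mat_vec)
  finally show ?thesis .
qed

lemma continuous_on_cinner [continuous_intros]:
  fixes f g :: "'a::topological_space \<Rightarrow> nat \<Rightarrow> complex"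
  assumes "\<And>i. continuous_on S (\<lambda>x. f x i)" "\<And>i. continuous_on S (\<lambda>x. g x i)"
  shows "continuous_on S (\<lambda>x. cinner n (f x) (g x))"
  unfolding cinner_def by (intro continuous_intros assms)

section \<open>Orthonormal families and the complementary projection\<close>

definition orthonormal_family :: "nat \<Rightarrow> nat \<Rightarrow> (nat \<Rightarrow> nat \<Rightarrow> complex) \<Rightarrow> bool" where
  "orthonormal_family n k v \<longleftrightarrow>
    (\<forall>i<k. \<forall>j<k. cinner n (v i) (v j) = (if i = j then 1 else 0))"

text \<open>For an orthonormal family this is Q e_x, where e_x is the unit vector and Q = I - sum_j
  v_j v_j^H projects onto the complement of the span. The diagonal of Q decides both whether the
  family can be extended and whether it is complete.\<close>

definition residual :: "nat \<Rightarrow> (nat \<Rightarrow> nat \<Rightarrow> complex) \<Rightarrow> nat \<Rightarrow> nat \<Rightarrow> complex" where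
  "residual k v x i = mat_id i x - (\<Sum>j<k. cnj (v j x) * v j i)"

lemma cinner_mat_id: "x < n \<Longrightarrow> cinner n u (\<lambda>i. mat_id i x) = cnj (u x)"
  by (simp add: cinner_def mat_id_def if_distrib cong: if_cong)

lemma cinner_sum_right: "cinner n u (\<lambda>i. \<Sum>j\<in>J. c j * v j i) = (\<Sum>j\<in>J. c j * cinner n u (v j))"
  unfolding cinner_def sum_distrib_left by (subst sum.swap) (simp add: mult.left_commute)

lemma cinner_residual:
  assumes v: "orthonormal_family n k v" and "i < k" "x < n"
  shows "cinner n (v i) (residual k v x) = 0"
proof -
  have "cinner n (v i) (residual k v x) = cnj (v i x) - (\<Sum>j<k. cnj (v j x) * cinner n (v i) (v j))"
    using \<open>x < n\<close> by (simp add: residual_def[abs_def] cinner_diff_right cinner_mat_id cinner_sum_right)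
  also have "(\<Sum>j<k. cnj (v j x) * cinner n (v i) (v j)) = (\<Sum>j<k. if i = j then cnj (v j x) else 0)"
    using v \<open>i < k\<close> unfolding orthonormal_family_def by (intro sum.cong) auto
  finally show ?thesis using \<open>i < k\<close> by simp
qed

text \<open>Q is a self-adjoint idempotent, so the squared norm of Q e_x is the diagonal entry of Q
  at x.\<close>

lemma cinner_residual_self:
  assumes "orthonormal_family n k v" and "x < n"
  shows "cinner n (residual k v x) (residual k v x) = residual k v x x"
proof -
  have *: "cinner n (residual k v x) (v j) = 0" if "j < k" for j
    using cinner_residual[OF assms(1) that assms(2)] by (subst cinner_commute) simp
  have "cinner n (residual k v x) (residual k v x)
      = cinner n (residual k v x) (\<lambda>i. mat_id i x - (\<Sum>j<k. cnj (v j x) * v j i))"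
    by (simp add: residual_def[abs_def])
  also have "\<dots> = cnj (residual k v x x)"
    using * \<open>x < n\<close> by (simp add: cinner_diff_right cinner_mat_id cinner_sum_right)
  finally show ?thesis
    by (metis cinner_commute complex_cnj_cnj)
qed

text \<open>The trace of Q is its rank; this takes the place of a dimension argument.\<close>

lemma sum_residual:
  assumes v: "orthonormal_family n k v"
  shows "(\<Sum>x<n. residual k v x x) = of_nat n - of_nat k"
proof -
  have "(\<Sum>x<n. \<Sum>j<k. cnj (v j x) * v j x) = (\<Sum>j<k. cinner n (v j) (v j))"
    by (subst sum.swap) (simp add: cinner_def)
  also have "\<dots> = (\<Sum>j<k. 1)"
    using v unfolding orthonormal_family_def by (intro sum.cong) auto
  finally show ?thesis by (simp add: residual_def mat_id_def sum_subtractf)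
qed

text \<open>The trace n - k of Q is nonzero, so some Q e_x has nonzero norm; normalised, it is the
  new vector.\<close>

lemma orthonormal_extend:
  assumes v: "orthonormal_family n k v" and "k < n"
  obtains u where "cinner n u u = 1" "\<And>i. i < k \<Longrightarrow> cinner n (v i) u = 0"
proof -
  define r where "r = residual k v"
  have orth: "cinner n (v i) (r x) = 0" if "i < k" "x < n" for i x
    using cinner_residual[OF v that] by (simp add: r_def)
  have "(\<Sum>x<n. r x x) \<noteq> 0"
    using sum_residual[OF v] \<open>k < n\<close> by (simp add: r_def)
  then obtain x where "x \<in> {..<n}" "r x x \<noteq> 0"
    by (rule sum.not_neutral_contains_not_neutral)
  then have x: "x < n" "cinner n (r x) (r x) \<noteq> 0"
    using cinner_residual_self[OF v] by (simp_all add: r_def)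
  define s where "s = (\<Sum>i<n. (cmod (r x i))\<^sup>2)"
  have s: "cinner n (r x) (r x) = of_real s" by (simp add: s_def cinner_self)
  have "s \<ge> 0" by (simp add: s_def sum_nonneg)
  with x s have "s > 0" by (auto simp: less_le)
  then have c: "1 / sqrt s * (1 / sqrt s * s) = 1" by (simp add: field_simps)
  define u where "u = (\<lambda>i. of_real (1 / sqrt s) * r x i)"
  have "cinner n u u = of_real (1 / sqrt s * (1 / sqrt s * s))"
    unfolding u_def cinner_simps s by (simp only: complex_cnj_complex_of_real of_real_mult)
  then have "cinner n u u = 1" unfolding c by simp
  moreover have "cinner n (v i) u = 0" if "i < k" for i
    unfolding u_def cinner_simps using orth[OF that x(1)] by simp
  ultimately show ?thesis by (rule that)
qed

text \<open>The new eigenvector maximises the Rayleigh quotient on the orthogonal complement of the given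
  ones; varying it in the direction of its own residual u = A w - m w shows u = 0.\<close>
lemma eigenvector_extend:
  assumes A: "hermitian n A" and v: "orthonormal_family n k v" and "k < n"
    and ev: "\<And>i x. i < k \<Longrightarrow> x < n \<Longrightarrow> mat_vec n A (v i) x = of_real (l i) * v i x"
  obtains w m where "cinner n w w = 1" "\<And>i. i < k \<Longrightarrow> cinner n (v i) w = 0"
    "\<And>x. x < n \<Longrightarrow> mat_vec n A w x = complex_of_real m * w x"
proof -
  \<comment> \<open>Vectors are functions on all naturals. Fixing the coordinates from
    \<open>n\<close> on to 0 makes this product of balls compact by Tychonoff, and it contains a
    copy of every unit vector.\<close>
  define P where "P = (\<Pi>\<^sub>E i\<in>UNIV. if i < n then cball (0::complex) 1 else {0})"
  have "compact P"
  proof -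
    have "compactin (product_topology (\<lambda>i. euclidean) UNIV) P"
      unfolding P_def by (subst compactin_PiE) (simp add: compactin_euclidean_iff)
    then show ?thesis
      by (simp add: euclidean_product_topology compactin_euclidean_iff)
  qed
  define C where "C = P \<inter> ({w. cinner n w w = 1} \<inter> (\<Inter>i<k. {w. cinner n (v i) w = 0}))"
  have "closed ({w. cinner n w w = 1} \<inter> (\<Inter>i<k. {w. cinner n (v i) w = 0}))"
    by (intro closed_Int closed_INT ballI closed_Collect_eq continuous_intros
        continuous_on_product_coordinates)
  with \<open>compact P\<close> have "compact C"
    unfolding C_def by (rule compact_Int_closed)
  define f where "f = (\<lambda>w. Re (cinner n w (mat_vec n A w)))"
  have "continuous_on C f"
    unfolding f_def mat_vec_def
    by (intro continuous_intros continuous_on_subset[OF continuous_on_product_coordinates]) auto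
  \<comment> \<open>\<open>cinner n\<close> sees only the entries below \<open>n\<close>, so a unit
    vector orthogonal to the family lands in \<open>C\<close> once its other entries are cut
    off.\<close>
  have inC: "\<exists>u'\<in>C. \<forall>i<n. u' i = u i"
    if "cinner n u u = 1" "\<And>i. i < k \<Longrightarrow> cinner n (v i) u = 0" for u
  proof
    define u' where "u' = (\<lambda>i. if i < n then u i else 0)"
    show "\<forall>i<n. u' i = u i" by (simp add: u'_def)
    have "cmod (u i) \<le> 1" if "i < n" for i
    proof -
      have "(cmod (u i))\<^sup>2 \<le> (\<Sum>i<n. (cmod (u i))\<^sup>2)"
        using \<open>i < n\<close> by (intro member_le_sum) auto
      also have "\<dots> = 1"
        using \<open>cinner n u u = 1\<close> unfolding cinner_self of_real_eq_1_iff .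
      finally show ?thesis by (simp add: power_le_one_iff)
    qed
    moreover have "cinner n w u' = cinner n w u" "cinner n u' u' = cinner n u u" for w
      by (auto simp: cinner_def u'_def)
    ultimately show "u' \<in> C"
      using that by (auto simp: C_def P_def u'_def)
  qed
  obtain u0 where "cinner n u0 u0 = 1" "\<And>i. i < k \<Longrightarrow> cinner n (v i) u0 = 0"
    using orthonormal_extend[OF v \<open>k < n\<close>] by blast
  then have "C \<noteq> {}" using inC by blast
  then obtain w where "w \<in> C" and max: "\<And>u. u \<in> C \<Longrightarrow> f u \<le> f w"
    using continuous_attains_sup[OF \<open>compact C\<close> _ \<open>continuous_on C f\<close>] by blast
  then have w1: "cinner n w w = 1" and w0: "\<And>i. i < k \<Longrightarrow> cinner n (v i) w = 0"
    by (auto simp: C_def)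
  define m where "m = f w"
  \<comment> \<open>Maximality on unit vectors extends to all vectors orthogonal to the family,
    because both sides scale by the squared norm.\<close>
  have ray: "f u \<le> m * Re (cinner n u u)" if u: "\<And>i. i < k \<Longrightarrow> cinner n (v i) u = 0" for u
  proof (cases "cinner n u u = 0")
    case True
    then have "u i = 0" if "i < n" for i using cinner_self_eq_0 that by blast
    then show ?thesis by (simp add: f_def cinner_def)
  next
    case False
    define s where "s = (\<Sum>i<n. (cmod (u i))\<^sup>2)"
    have s: "cinner n u u = of_real s" by (simp add: s_def cinner_self)
    have "s \<ge> 0" by (simp add: s_def sum_nonneg)
    with False s have "s > 0" by (auto simp: less_le)
    then have ss: "sqrt s * sqrt s = s" by simp
    define u1 where "u1 = (\<lambda>i. of_real (1 / sqrt s) * u i)"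
    have "cinner n u1 u1 = of_real (1 / sqrt s * (1 / sqrt s) * s)"
      unfolding u1_def cinner_simps s by (simp only: complex_cnj_complex_of_real of_real_mult mult.assoc)
    then have "cinner n u1 u1 = 1" using \<open>s > 0\<close> by simp
    moreover have "cinner n (v i) u1 = 0" if "i < k" for i
      unfolding u1_def cinner_simps using u that by simp
    ultimately obtain u' where u': "u' \<in> C" "\<forall>i<n. u' i = u1 i" using inC by blast
    have "f u' = f u1"
      unfolding f_def cinner_mat_vec using u'(2) by (intro arg_cong[of _ _ Re] sum.cong) auto
    also have "\<dots> = Re (of_real (1 / sqrt s * (1 / sqrt s)) * cinner n u (mat_vec n A u))"
      unfolding f_def u1_def mat_vec_scale cinner_simps by (simp only: complex_cnj_complex_of_real of_real_mult mult.assoc)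
    also have "\<dots> = f u / s"
      using ss unfolding Re_complex_of_real_mult f_def by simp
    finally have "f u / s \<le> m" using max[OF u'(1)] by (simp add: m_def)
    then show ?thesis using \<open>s > 0\<close> s by (simp add: divide_le_eq)
  qed
  define u where "u = (\<lambda>i. mat_vec n A w i - of_real m * w i)"
  have u0: "cinner n (v i) u = 0" if "i < k" for i
  proof -
    have "cinner n (v i) (mat_vec n A w) = cinner n (mat_vec n A (v i)) w"
      using hermitian_cinner[OF A] by simp
    also have "\<dots> = cinner n (\<lambda>x. of_real (l i) * v i x) w"
      using ev[OF that] by (intro cinner_cong) auto
    also have "\<dots> = 0" using w0[OF that] by (simp add: cinner_simps)
    finally show ?thesis using w0[OF that] by (simp add: u_def cinner_simps)
  qed
  define q where "q = Re (cinner n u u)"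
  define B where "B = m * q - f u"
  \<comment> \<open>Apply \<open>ray\<close> to w + t u, which is still orthogonal to the family.
    The constant terms and the terms with Re <u, w> cancel; what remains is linear in t on the left
    and quadratic on the right, so q must vanish.\<close>
  have var: "2 * t * q \<le> t\<^sup>2 * B" for t :: real
  proof -
    define z where "z = (\<lambda>i. w i + of_real t * u i)"
    have "f z \<le> m * Re (cinner n z z)"
      by (rule ray) (simp add: z_def cinner_simps w0 u0)
    moreover have "f z = f w + 2 * t * Re (cinner n u (mat_vec n A w)) + t\<^sup>2 * f u"
    proof -
      have "cinner n w (mat_vec n A u) = cnj (cinner n u (mat_vec n A w))"
        by (metis A cinner_commute hermitian_cinner)
      then have "Re (cinner n w (mat_vec n A u)) = Re (cinner n u (mat_vec n A w))" by simp
      then show ?thesis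
        unfolding f_def z_def mat_vec_linear cinner_simps by (simp add: power2_eq_square algebra_simps)
    qed
    moreover have "Re (cinner n z z) = 1 + 2 * t * Re (cinner n u w) + t\<^sup>2 * q"
    proof -
      have "Re (cinner n w u) = Re (cinner n u w)" by (subst cinner_commute) simp
      then show ?thesis
        unfolding z_def cinner_simps q_def w1 by (simp add: power2_eq_square algebra_simps)
    qed
    moreover have "Re (cinner n u (mat_vec n A w)) = q + m * Re (cinner n u w)"
      unfolding q_def by (subst (3) u_def) (simp add: cinner_simps)
    ultimately show ?thesis
      unfolding B_def m_def[symmetric] by (simp add: algebra_simps)
  qed
  have "q \<ge> 0" by (simp add: q_def cinner_self sum_nonneg)
  have "q = 0"
  proof (rule ccontr)
    assume "q \<noteq> 0"
    with \<open>q \<ge> 0\<close> have "q > 0" by simp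
    \<comment> \<open>This choice gives t B <= q, while \<open>var\<close> demands 2 q <= t
      B.\<close>
    define t where "t = q / (\<bar>B\<bar> + 1)"
    have "t > 0" using \<open>q > 0\<close> by (simp add: t_def)
    have "2 * q \<le> t * B"
      using var[of t] \<open>t > 0\<close> by (simp add: power2_eq_square)
    also have "\<dots> \<le> t * (\<bar>B\<bar> + 1)" using \<open>t > 0\<close> by (intro mult_left_mono) auto
    also have "\<dots> = q" by (simp add: t_def)
    finally show False using \<open>q > 0\<close> by simp
  qed
  then have "cinner n u u = 0" by (simp add: q_def cinner_self)
  then have "u x = 0" if "x < n" for x using cinner_self_eq_0 that by blast
  then show ?thesis
    using w1 w0 by (intro that[of w m]) (auto simp: u_def)
qed

lemma orthonormal_eigenvectors:
  assumes A: "hermitian n A" and "k \<le> n"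
  shows "\<exists>v l. orthonormal_family n k v \<and>
    (\<forall>i<k. \<forall>x<n. mat_vec n A (v i) x = complex_of_real (l i) * v i x)"
  using \<open>k \<le> n\<close>
proof (induction k)
  case 0
  then show ?case by (simp add: orthonormal_family_def)
next
  case (Suc k)
  then obtain v l where v: "orthonormal_family n k v"
    and ev: "\<And>i x. i < k \<Longrightarrow> x < n \<Longrightarrow> mat_vec n A (v i) x = complex_of_real (l i) * v i x"
    by auto
  obtain w m where w: "cinner n w w = 1" "\<And>i. i < k \<Longrightarrow> cinner n (v i) w = 0"
    "\<And>x. x < n \<Longrightarrow> mat_vec n A w x = complex_of_real m * w x"
    using eigenvector_extend[OF A v _ ev] Suc.prems by (metis Suc_le_eq)
  have w': "cinner n w (v i) = 0" if "i < k" for i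
    using w(2)[OF that] by (subst cinner_commute) simp
  have "orthonormal_family n (Suc k) (v(k := w))"
    using v w w' by (auto simp: orthonormal_family_def less_Suc_eq)
  moreover have "\<forall>i<Suc k. \<forall>x<n. mat_vec n A ((v(k := w)) i) x
      = complex_of_real ((l(k := m)) i) * (v(k := w)) i x"
    using ev w(3) by (auto simp: less_Suc_eq)
  ultimately show ?case by blast
qed

text \<open>For k = n the trace of Q is 0. It is also the sum of the squared norms of all residuals,
  so each residual vanishes and Q = 0.\<close>

lemma orthonormal_basis_complete:
  assumes v: "orthonormal_family n n v" and "i < n" "j < n"
  shows "(\<Sum>k<n. v k i * cnj (v k j)) = mat_id i j"
proof -
  have "(\<Sum>x<n. residual n v x x) = 0"
    using sum_residual[OF v] by simp
  then have "(\<Sum>x<n. cinner n (residual n v x) (residual n v x)) = 0"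
    using cinner_residual_self[OF v] by simp
  then have "(\<Sum>x<n. \<Sum>i<n. (cmod (residual n v x i))\<^sup>2) = 0"
    unfolding cinner_self of_real_sum[symmetric] of_real_eq_0_iff .
  then have "residual n v j i = 0"
    using assms(2,3) by (subst (asm) sum_nonneg_eq_0_iff, simp, simp add: sum_nonneg)
      (subst (asm) sum_nonneg_eq_0_iff, auto)
  then show ?thesis by (simp add: residual_def mult.commute)
qed

text \<open>Apply A to the resolution of the identity I = sum_k v_k v_k^H given by a full
  orthonormal family of eigenvectors.\<close>

theorem spectral_decomposition:
  assumes A: "hermitian n A"
  obtains v l where "orthonormal_family n n v"
    "\<And>i j. i < n \<Longrightarrow> j < n \<Longrightarrow> A i j = (\<Sum>k<n. complex_of_real (l k) * (v k i * cnj (v k j)))"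
proof -
  obtain v l where v: "orthonormal_family n n v"
    and ev: "\<And>i x. i < n \<Longrightarrow> x < n \<Longrightarrow> mat_vec n A (v i) x = complex_of_real (l i) * v i x"
    using orthonormal_eigenvectors[OF A, of n] by auto
  have "A i j = (\<Sum>k<n. complex_of_real (l k) * (v k i * cnj (v k j)))" if "i < n" "j < n" for i j
  proof -
    have "A i j = (\<Sum>x<n. A i x * mat_id x j)"
      using \<open>j < n\<close> by (simp add: mat_id_def if_distrib cong: if_cong)
    also have "\<dots> = (\<Sum>x<n. A i x * (\<Sum>k<n. v k x * cnj (v k j)))"
      using orthonormal_basis_complete[OF v] \<open>j < n\<close> by simp
    also have "\<dots> = (\<Sum>k<n. mat_vec n A (v k) i * cnj (v k j))"
      by (simp add: mat_vec_def sum_distrib_left sum_distrib_right mult.assoc)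
        (rule sum.swap)
    also have "\<dots> = (\<Sum>k<n. complex_of_real (l k) * (v k i * cnj (v k j)))"
      using ev \<open>i < n\<close> by (simp add: mult.assoc)
    finally show ?thesis .
  qed
  with v show ?thesis by (rule that)
qed

section \<open>Traces of products and positivity\<close>

text \<open>Tr(AB), and below Tr(ABC), as plain sums. With a state in the last slot they are the
  expectation of an observable and of a product of two observables.\<close>

definition trace2 :: "nat \<Rightarrow> (nat \<Rightarrow> nat \<Rightarrow> complex) \<Rightarrow> (nat \<Rightarrow> nat \<Rightarrow> complex) \<Rightarrow> complex" where
  "trace2 n A B = (\<Sum>i<n. \<Sum>j<n. A i j * B j i)"

definition trace3 :: "nat \<Rightarrow> (nat \<Rightarrow> nat \<Rightarrow> complex) \<Rightarrow> (nat \<Rightarrow> nat \<Rightarrow> complex) \<Rightarrow> (nat \<Rightarrow> nat \<Rightarrow> complex) \<Rightarrow> complex" where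
  "trace3 n A B C = (\<Sum>i<n. \<Sum>j<n. \<Sum>k<n. A i j * B j k * C k i)"

lemma mat_trace_mult: "mat_trace n (mat_mult n A B) = trace2 n A B"
  by (simp add: mat_trace_def mat_mult_def trace2_def)

lemma trace2_mat_mult: "trace2 n (mat_mult n A B) C = trace3 n A B C"
proof -
  have "trace2 n (mat_mult n A B) C = (\<Sum>i<n. \<Sum>k<n. \<Sum>j<n. A i j * B j k * C k i)"
    by (simp add: trace2_def mat_mult_def sum_distrib_right)
  also have "\<dots> = trace3 n A B C"
    unfolding trace3_def by (rule sum.cong[OF refl], rule sum.swap)
  finally show ?thesis .
qed

lemma trace2_commute: "trace2 n A B = trace2 n B A"
  unfolding trace2_def by (subst sum.swap) (simp add: mult.commute)

lemma trace3_rotate: "trace3 n A B C = trace3 n B C A"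
proof -
  have "trace3 n A B C = (\<Sum>j<n. \<Sum>i<n. \<Sum>k<n. A i j * B j k * C k i)"
    unfolding trace3_def by (rule sum.swap)
  also have "\<dots> = (\<Sum>j<n. \<Sum>k<n. \<Sum>i<n. A i j * B j k * C k i)"
    by (rule sum.cong[OF refl], rule sum.swap)
  also have "\<dots> = trace3 n B C A"
    by (simp add: trace3_def mult_ac)
  finally show ?thesis .
qed

lemma trace2_cong:
  "(\<And>i j. i < n \<Longrightarrow> j < n \<Longrightarrow> A i j = A' i j) \<Longrightarrow> (\<And>i j. i < n \<Longrightarrow> j < n \<Longrightarrow> B i j = B' i j) \<Longrightarrow>
    trace2 n A B = trace2 n A' B'"
  by (simp add: trace2_def)

lemma trace2_sum_left: "trace2 n (\<lambda>i j. \<Sum>x\<in>I. A x i j) B = (\<Sum>x\<in>I. trace2 n (A x) B)"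
proof -
  have "trace2 n (\<lambda>i j. \<Sum>x\<in>I. A x i j) B = (\<Sum>i<n. \<Sum>x\<in>I. \<Sum>j<n. A x i j * B j i)"
    unfolding trace2_def sum_distrib_right by (rule sum.cong[OF refl], rule sum.swap)
  also have "\<dots> = (\<Sum>x\<in>I. trace2 n (A x) B)"
    unfolding trace2_def by (rule sum.swap)
  finally show ?thesis .
qed

lemma trace2_sum_right: "trace2 n A (\<lambda>i j. \<Sum>x\<in>I. B x i j) = (\<Sum>x\<in>I. trace2 n A (B x))"
  by (simp add: trace2_commute[of _ A] trace2_sum_left)

lemma trace2_scale_left: "trace2 n (\<lambda>i j. c * A i j) B = c * trace2 n A B"
  by (simp add: trace2_def sum_distrib_left mult.assoc)

lemma trace3_sum_1: "trace3 n (\<lambda>i j. \<Sum>x\<in>I. A x i j) B C = (\<Sum>x\<in>I. trace3 n (A x) B C)"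
proof -
  have "mat_mult n (\<lambda>i j. \<Sum>x\<in>I. A x i j) B = (\<lambda>i j. \<Sum>x\<in>I. mat_mult n (A x) B i j)"
    unfolding mat_mult_def sum_distrib_right by (intro ext, rule sum.swap)
  then show ?thesis by (simp add: trace2_sum_left flip: trace2_mat_mult)
qed

lemma trace3_sum_2: "trace3 n B (\<lambda>i j. \<Sum>x\<in>I. A x i j) C = (\<Sum>x\<in>I. trace3 n B (A x) C)"
  by (simp add: trace3_rotate[of n B] trace3_sum_1)

lemma trace3_sum_3: "trace3 n B C (\<lambda>i j. \<Sum>x\<in>I. A x i j) = (\<Sum>x\<in>I. trace3 n B C (A x))"
  by (simp add: trace3_rotate[of n B] trace3_sum_2)

lemma trace3_scale_1: "trace3 n (\<lambda>i j. c * A i j) B C = c * trace3 n A B C"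
  by (simp add: trace3_def sum_distrib_left mult.assoc)

lemma trace3_scale_2: "trace3 n A (\<lambda>i j. c * B i j) C = c * trace3 n A B C"
  by (simp add: trace3_def sum_distrib_left mult_ac)

lemma trace3_add_1: "trace3 n (\<lambda>i j. A i j + B i j) C D = trace3 n A C D + trace3 n B C D"
  by (simp add: trace3_def sum.distrib algebra_simps)

lemma trace3_add_2: "trace3 n C (\<lambda>i j. A i j + B i j) D = trace3 n C A D + trace3 n C B D"
  by (simp add: trace3_def sum.distrib algebra_simps)

lemma trace3_mat_id_1: "trace3 n mat_id A B = trace2 n A B"
proof -
  have "mat_mult n mat_id A i j = A i j" if "i < n" for i j
    using that by (simp add: mat_mult_def mat_id_def if_distrib[of "\<lambda>x. x * _"] cong: if_cong)
  then show ?thesis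
    unfolding trace2_mat_mult[symmetric] by (intro trace2_cong) auto
qed

lemma trace3_mat_id_2: "trace3 n A mat_id B = trace2 n A B"
  by (simp add: trace3_rotate[of n A] trace3_mat_id_1 trace2_commute)

lemma trace2_mat_id: "trace2 n mat_id A = mat_trace n A"
  by (simp add: trace2_def mat_trace_def mat_id_def if_distrib[of "\<lambda>x. x * _"] cong: if_cong)

section \<open>Traces with Hermitian and positive semidefinite factors\<close>

lemma hermitian_cnj: "hermitian n A \<Longrightarrow> i < n \<Longrightarrow> j < n \<Longrightarrow> cnj (A i j) = A j i"
  unfolding hermitian_def by metis

lemma trace2_hermitian_real:
  assumes "hermitian n A" "hermitian n B"
  shows "trace2 n A B = of_real (Re (trace2 n A B))"
proof -
  have "cnj (trace2 n A B) = (\<Sum>i<n. \<Sum>j<n. A j i * B i j)"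
    unfolding trace2_def by (simp add: hermitian_cnj[OF assms(1)] hermitian_cnj[OF assms(2)])
  also have "\<dots> = trace2 n A B"
    unfolding trace2_def by (rule sum.swap)
  finally show ?thesis
    by (metis Reals_cnj_iff of_real_Re)
qed

lemma trace3_cnj:
  assumes "hermitian n A" "hermitian n B" "hermitian n C"
  shows "cnj (trace3 n A B C) = trace3 n C B A"
proof -
  have "cnj (trace3 n A B C) = (\<Sum>i<n. \<Sum>j<n. \<Sum>k<n. C i k * B k j * A j i)"
    unfolding trace3_def
    by (simp add: hermitian_cnj[OF assms(1)] hermitian_cnj[OF assms(2)] hermitian_cnj[OF assms(3)] mult_ac)
  also have "\<dots> = trace3 n C B A"
    unfolding trace3_def by (rule sum.cong[OF refl], rule sum.swap)
  finally show ?thesis .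
qed

text \<open>Adjoints reverse products. Together with the cyclic rotation
  \<open>trace3_rotate\<close>, the real part becomes independent of the order of three Hermitian
  factors.\<close>

lemma Re_trace3_reverse:
  assumes "hermitian n A" "hermitian n B" "hermitian n C"
  shows "Re (trace3 n A B C) = Re (trace3 n C B A)"
  by (metis trace3_cnj[OF assms] cnj.sel(1))

lemma psd_hermitian: "psd n A \<Longrightarrow> hermitian n A"
  by (simp add: psd_def)

lemma psd_cinner: "psd n A \<Longrightarrow> 0 \<le> Re (cinner n v (mat_vec n A v))"
  by (simp add: psd_def cinner_mat_vec)

text \<open>The quadratic form at v becomes sum_k |<v, w_k>|^2. The type of the index set is left
  open because tensor products use functions as indices.\<close>

lemma psd_gram:
  assumes "\<And>i j. i < n \<Longrightarrow> j < n \<Longrightarrow> A i j = (\<Sum>k\<in>I. w k i * cnj (w k j))"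
  shows "psd n A"
  unfolding psd_def
proof (intro conjI allI)
  show "hermitian n A"
    by (simp add: hermitian_def assms mult.commute)
next
  fix v :: "nat \<Rightarrow> complex"
  have "(\<Sum>i<n. \<Sum>j<n. cnj (v i) * A i j * v j)
      = (\<Sum>i<n. \<Sum>j<n. \<Sum>k\<in>I. (cnj (v i) * w k i) * cnj (cnj (v j) * w k j))"
    by (simp add: assms sum_distrib_left sum_distrib_right mult_ac)
  also have "\<dots> = (\<Sum>k\<in>I. \<Sum>i<n. \<Sum>j<n. (cnj (v i) * w k i) * cnj (cnj (v j) * w k j))"
    by (subst sum.swap, subst (2) sum.swap) (rule refl)
  also have "\<dots> = (\<Sum>k\<in>I. of_real ((cmod (cinner n v (w k)))\<^sup>2))"
    by (simp only: complex_norm_square cinner_def sum_product cnj_sum)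
  finally show "0 \<le> Re (\<Sum>i<n. \<Sum>j<n. cnj (v i) * A i j * v j)"
    by (simp add: sum_nonneg)
qed

text \<open>The vectors are the eigenvectors scaled by the square roots of their eigenvalues;
  evaluating the form at an eigenvector shows that its eigenvalue is nonnegative.\<close>

lemma psd_imp_gram:
  assumes "psd n A"
  obtains w where "\<And>i j. i < n \<Longrightarrow> j < n \<Longrightarrow> A i j = (\<Sum>k<n. w k i * cnj (w k j))"
proof -
  obtain v l where v: "orthonormal_family n n v"
    and A: "\<And>i j. i < n \<Longrightarrow> j < n \<Longrightarrow> A i j = (\<Sum>k<n. complex_of_real (l k) * (v k i * cnj (v k j)))"
    using spectral_decomposition[OF psd_hermitian[OF assms]] by metis
  have "l m \<ge> 0" if "m < n" for m
  proof -
    have "mat_vec n A (v m) i = of_real (l m) * v m i" if "i < n" for i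
    proof -
      have "mat_vec n A (v m) i
          = (\<Sum>j<n. \<Sum>k<n. complex_of_real (l k) * v k i * (cnj (v k j) * v m j))"
        using A \<open>i < n\<close> by (simp add: mat_vec_def sum_distrib_right mult.assoc)
      also have "\<dots> = (\<Sum>k<n. complex_of_real (l k) * v k i * cinner n (v k) (v m))"
        by (subst sum.swap) (simp add: cinner_def sum_distrib_left)
      also have "\<dots> = (\<Sum>k<n. if k = m then complex_of_real (l k) * v k i else 0)"
        using v \<open>m < n\<close> unfolding orthonormal_family_def by (intro sum.cong) auto
      finally show ?thesis using \<open>m < n\<close> by simp
    qed
    then have "cinner n (v m) (mat_vec n A (v m)) = cinner n (v m) (\<lambda>i. of_real (l m) * v m i)"
      by (intro cinner_cong) auto
    also have "\<dots> = of_real (l m)"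
      using v \<open>m < n\<close> by (simp add: cinner_simps orthonormal_family_def)
    finally show ?thesis
      using psd_cinner[OF assms, of "v m"] by simp
  qed
  then have "complex_of_real (l k) = of_real (sqrt (l k)) * of_real (sqrt (l k))" if "k < n" for k
    using that by (simp flip: of_real_mult)
  then have "A i j = (\<Sum>k<n. (of_real (sqrt (l k)) * v k i) * cnj (of_real (sqrt (l k)) * v k j))"
    if "i < n" "j < n" for i j
    unfolding A[OF that] by (intro sum.cong refl) (auto simp: mult_ac)
  then show ?thesis by (rule that)
qed

text \<open>With A = sum_k w_k w_k^H the trace is sum_k w_k^H B w_k, a sum of values of the form of
  B.\<close>

lemma trace2_psd_nonneg:
  assumes "psd n A" "psd n B"
  shows "0 \<le> Re (trace2 n A B)"
proof -
  obtain w where w: "\<And>i j. i < n \<Longrightarrow> j < n \<Longrightarrow> A i j = (\<Sum>k<n. w k i * cnj (w k j))"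
    using psd_imp_gram[OF assms(1)] by blast
  have "trace2 n A B = trace2 n (\<lambda>i j. \<Sum>k<n. w k i * cnj (w k j)) B"
    using w by (intro trace2_cong) auto
  also have "\<dots> = (\<Sum>k<n. cinner n (w k) (mat_vec n B (w k)))"
    unfolding trace2_sum_left
    unfolding trace2_def cinner_mat_vec
    by (rule sum.cong[OF refl], subst sum.swap) (simp add: mult_ac)
  finally show ?thesis
    using psd_cinner[OF assms(2)] by (simp add: sum_nonneg)
qed

lemma trace3_square_nonneg:
  assumes "hermitian n A" "psd n B"
  shows "0 \<le> Re (trace3 n A A B)"
proof -
  have "psd n (mat_mult n A A)"
    by (rule psd_gram[where I = "{..<n}" and w = "\<lambda>k i. A i k"])
      (simp add: mat_mult_def hermitian_cnj[OF assms(1)])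
  then show ?thesis
    using trace2_psd_nonneg[OF _ assms(2)] by (simp flip: trace2_mat_mult)
qed

text \<open>Cauchy-Schwarz in its arithmetic-mean form: expand Tr((A + B)^2 C) >= 0 and Tr((A - B)^2
  C) >= 0. The two mixed terms have equal real parts.\<close>

lemma trace3_abs_le:
  assumes A: "hermitian n A" and B: "hermitian n B" and C: "psd n C"
  shows "2 * \<bar>Re (trace3 n A B C)\<bar> \<le> Re (trace3 n A A C) + Re (trace3 n B B C)"
proof -
  have sym: "Re (trace3 n B A C) = Re (trace3 n A B C)"
    using Re_trace3_reverse[OF B A psd_hermitian[OF C]] trace3_rotate by metis
  have "0 \<le> Re (trace3 n A A C) + Re (trace3 n B B C) + 2 * e * Re (trace3 n A B C)"
    if "e = 1 \<or> e = -1" for e :: real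
  proof -
    define D where "D = (\<lambda>i j. A i j + of_real e * B i j)"
    have "hermitian n D"
      using A B unfolding hermitian_def D_def by (metis complex_cnj_add complex_cnj_complex_of_real complex_cnj_mult)
    then have "0 \<le> Re (trace3 n D D C)"
      using C by (rule trace3_square_nonneg)
    also have "trace3 n D D C = trace3 n A A C + of_real e * trace3 n A B C
        + of_real e * trace3 n B A C + of_real (e * e) * trace3 n B B C"
      unfolding D_def trace3_add_1 trace3_add_2 trace3_scale_1 trace3_scale_2
      by (simp add: algebra_simps)
    finally show ?thesis using that sym by auto
  qed
  from this[of 1] this[of "-1"] show ?thesis by simp
qed

section \<open>Tensor products\<close>

text \<open>Indices below d^T correspond to their tuples of base-d digits, so the sum of products is
  an expanded product of sums. The induction splits the range into blocks with a fixed leading digit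
  m; adding m d^T leaves the lower digits alone. All multiplicativity of \<open>tensor_prod\<close>
  rests on this.\<close>

lemma sum_prod_digits:
  fixes h :: "nat \<Rightarrow> nat \<Rightarrow> 'a::comm_semiring_1"
  assumes "d > 0"
  shows "(\<Sum>k<d ^ T. \<Prod>t<T. h t ((k div d ^ t) mod d)) = (\<Prod>t<T. \<Sum>c<d. h t c)"
proof (induction T)
  case 0
  then show ?case by simp
next
  case (Suc T)
  define g where "g = (\<lambda>k. \<Prod>t<T. h t ((k div d ^ t) mod d))"
  have "d ^ T > 0" using assms by simp
  have dig: "(m * d ^ T + k) div d ^ t mod d = k div d ^ t mod d" if "t < T" for m k t
  proof -
    have "d ^ T = d ^ t * (d * d ^ (T - Suc t))"
      using that by (metis Suc_diff_Suc le_add_diff_inverse less_imp_le_nat power_Suc power_add)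
    then have "m * d ^ T + k = k + d ^ t * (d * (d ^ (T - Suc t) * m))"
      by (simp add: mult_ac)
    then show ?thesis by (rule ssubst) (use assms in simp)
  qed
  have step: "(\<Prod>t<Suc T. h t ((k' div d ^ t) mod d)) = g k * h T m"
    if "k' = m * d ^ T + k" "k < d ^ T" "m < d" for k' m k
    using that dig \<open>d ^ T > 0\<close> by (simp add: g_def)
  have "(\<Sum>k<d ^ Suc T. \<Prod>t<Suc T. h t ((k div d ^ t) mod d))
      = (\<Sum>m<d. \<Sum>k\<in>{m * d ^ T..<m * d ^ T + d ^ T}. \<Prod>t<Suc T. h t ((k div d ^ t) mod d))"
    by (subst sum.nat_group) simp
  also have "\<dots> = (\<Sum>m<d. \<Sum>k<d ^ T. g k * h T m)"
  proof (rule sum.cong[OF refl])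
    fix m assume "m \<in> {..<d}"
    let ?F = "\<lambda>k. \<Prod>t<Suc T. h t ((k div d ^ t) mod d)"
    have "sum ?F {m * d ^ T..<m * d ^ T + d ^ T} = sum ?F {0 + m * d ^ T..<d ^ T + m * d ^ T}"
      by (simp only: add_0 add.commute)
    also have "\<dots> = (\<Sum>k\<in>{0..<d ^ T}. ?F (k + m * d ^ T))"
      by (rule sum.shift_bounds_nat_ivl)
    also have "\<dots> = (\<Sum>k<d ^ T. g k * h T m)"
      using \<open>m \<in> {..<d}\<close> unfolding atLeast0LessThan by (intro sum.cong refl step) auto
    finally show "sum ?F {m * d ^ T..<m * d ^ T + d ^ T} = (\<Sum>k<d ^ T. g k * h T m)" .
  qed
  also have "\<dots> = (\<Sum>k<d ^ T. g k) * (\<Sum>m<d. h T m)"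
    by (subst sum.swap) (simp add: sum_product)
  also have "\<dots> = (\<Prod>t<Suc T. \<Sum>c<d. h t c)"
    using Suc by (simp add: g_def)
  finally show ?case .
qed

lemma mat_mult_tensor:
  assumes "d > 0"
  shows "mat_mult (d ^ T) (tensor_prod d T A) (tensor_prod d T B)
    = tensor_prod d T (\<lambda>t. mat_mult d (A t) (B t))"
  by (intro ext) (simp add: mat_mult_def tensor_prod_def flip: prod.distrib sum_prod_digits[OF assms])

lemma mat_trace_tensor:
  assumes "d > 0"
  shows "mat_trace (d ^ T) (tensor_prod d T A) = (\<Prod>t<T. mat_trace d (A t))"
  by (simp add: mat_trace_def tensor_prod_def flip: sum_prod_digits[OF assms])

lemma trace2_tensor:
  assumes "d > 0"
  shows "trace2 (d ^ T) (tensor_prod d T A) (tensor_prod d T B) = (\<Prod>t<T. trace2 d (A t) (B t))"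
  by (simp add: mat_mult_tensor mat_trace_tensor assms flip: mat_trace_mult)

lemma trace3_tensor:
  assumes "d > 0"
  shows "trace3 (d ^ T) (tensor_prod d T A) (tensor_prod d T B) (tensor_prod d T C)
    = (\<Prod>t<T. trace3 d (A t) (B t) (C t))"
  by (simp add: mat_mult_tensor trace2_tensor assms flip: trace2_mat_mult)

text \<open>Tensor products of Gram vectors of the factors are Gram vectors of the product; the
  index \<open>f\<close> selects one vector for each factor.\<close>

lemma psd_tensor:
  assumes "d > 0" and "\<And>t. t < T \<Longrightarrow> psd d (A t)"
  shows "psd (d ^ T) (tensor_prod d T A)"
proof -
  have "\<exists>w. \<forall>i<d. \<forall>j<d. A t i j = (\<Sum>k<d. w k i * cnj (w k j))" if "t < T" for t
    using psd_imp_gram[OF assms(2)[OF that]] by metis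
  then obtain w where w: "\<And>t i j. t < T \<Longrightarrow> i < d \<Longrightarrow> j < d \<Longrightarrow>
      A t i j = (\<Sum>k<d. w t k i * cnj (w t k j))"
    by metis
  show ?thesis
  proof (rule psd_gram)
    fix i j
    have "tensor_prod d T A i j
        = (\<Prod>t<T. \<Sum>k<d. w t k ((i div d ^ t) mod d) * cnj (w t k ((j div d ^ t) mod d)))"
      unfolding tensor_prod_def using assms(1) by (intro prod.cong refl w) auto
    also have "\<dots> = (\<Sum>f\<in>PiE {..<T} (\<lambda>_. {..<d}).
        \<Prod>t<T. w t (f t) ((i div d ^ t) mod d) * cnj (w t (f t) ((j div d ^ t) mod d)))"
      by (rule prod_sum_PiE) auto
    also have "\<dots> = (\<Sum>f\<in>PiE {..<T} (\<lambda>_. {..<d}). (\<Prod>t<T. w t (f t) ((i div d ^ t) mod d))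
        * cnj (\<Prod>t<T. w t (f t) ((j div d ^ t) mod d)))"
      by (simp add: prod.distrib)
    finally show "tensor_prod d T A i j = \<dots>" .
  qed
qed

section \<open>Swap operators\<close>

definition unit_mat :: "nat \<Rightarrow> nat \<Rightarrow> nat \<Rightarrow> nat \<Rightarrow> complex" where
  "unit_mat a b i j = (if i = a \<and> j = b then 1 else 0)"

text \<open>The swap of s and t is the sum over a, b of the elementary tensors with E_ab at s, E_ba
  at t and the identity elsewhere. These are their factors, so that traces can be evaluated position
  by position.\<close>

definition swap_factor :: "nat \<Rightarrow> nat \<Rightarrow> nat \<Rightarrow> nat \<Rightarrow> nat \<Rightarrow> nat \<Rightarrow> nat \<Rightarrow> complex" where
  "swap_factor s t a b u = (if u = s then unit_mat a b else if u = t then unit_mat b a else mat_id)"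

text \<open>The operator exchanging tensor factors s and t, expanded in matrix units. It is set to 0 for
  s = t so that sums over all index pairs are sums over distinct indices.\<close>
definition swap_op :: "nat \<Rightarrow> nat \<Rightarrow> nat \<Rightarrow> nat \<Rightarrow> nat \<Rightarrow> nat \<Rightarrow> complex" where
  "swap_op d T s t = (\<lambda>i j. if s = t then 0
     else \<Sum>a<d. \<Sum>b<d. tensor_prod d T (swap_factor s t a b) i j)"

lemma swap_op_self: "swap_op d T s s = (\<lambda>i j. 0)"
  by (simp add: swap_op_def)

lemma swap_op_commute: "swap_op d T s t = swap_op d T t s"
proof (cases "s = t")
  case False
  then have "swap_factor s t a b = swap_factor t s b a" for a b
    by (auto simp: swap_factor_def)
  then show ?thesis
    unfolding swap_op_def by (intro ext) (auto intro: sum.swap)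
qed simp

text \<open>Conjugate transposition turns the (a, b) term into the (b, a) term. This is an identity
  of single entries, hence the arbitrary \<open>n\<close>.\<close>

lemma hermitian_swap_op: "hermitian n (swap_op d T s t)"
proof -
  have fac: "cnj (swap_factor s t a b u j i) = swap_factor s t b a u i j" for a b u i j
    by (simp add: swap_factor_def unit_mat_def mat_id_def)
  have "cnj (swap_op d T s t j i) = swap_op d T s t i j" for i j
    by (cases "s = t") (simp_all add: swap_op_def tensor_prod_def fac, rule sum.swap)
  then show ?thesis
    unfolding hermitian_def by simp
qed

lemma trace2_unit_mat:
  assumes "a < d" "b < d"
  shows "trace2 d (unit_mat a b) A = A b a"
proof -
  have "trace2 d (unit_mat a b) A = (\<Sum>i<d. \<Sum>j<d. if j = b then if i = a then A j i else 0 else 0)"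
    unfolding trace2_def by (intro sum.cong refl) (simp add: unit_mat_def)
  then show ?thesis using assms by simp
qed

lemma mat_mult_unit_mat:
  assumes "b < d"
  shows "mat_mult d (unit_mat a b) (unit_mat c e) = (\<lambda>i j. if b = c then unit_mat a e i j else 0)"
proof (intro ext)
  fix i j
  have "mat_mult d (unit_mat a b) (unit_mat c e) i j
      = (\<Sum>k<d. if k = b then if b = c then unit_mat a e i j else 0 else 0)"
    unfolding mat_mult_def by (intro sum.cong refl) (auto simp: unit_mat_def)
  then show "mat_mult d (unit_mat a b) (unit_mat c e) i j = (if b = c then unit_mat a e i j else 0)"
    using assms by simp
qed

lemma trace3_unit_mat:
  assumes "a < d" "b < d" "c < d" "e < d"
  shows "trace3 d (unit_mat a b) (unit_mat c e) A = (if b = c then A e a else 0)"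
proof -
  have "trace3 d (unit_mat a b) (unit_mat c e) A
      = trace2 d (\<lambda>i j. if b = c then unit_mat a e i j else 0) A"
    using assms by (simp add: mat_mult_unit_mat flip: trace2_mat_mult)
  then show ?thesis
    using assms by (simp add: trace2_unit_mat trace2_def[of d "\<lambda>i j. 0"])
qed

lemma density_psd: "density d A \<Longrightarrow> psd d A"
  and density_hermitian: "density d A \<Longrightarrow> hermitian d A"
  and density_trace: "density d A \<Longrightarrow> mat_trace d A = 1"
  by (simp_all add: density_def psd_def)

section \<open>Expectations of one swap and of two swaps in a product state\<close>

context
  fixes d T :: nat and \<rho> :: "nat \<Rightarrow> nat \<Rightarrow> nat \<Rightarrow> complex"
  assumes d: "d > 0" and dens: "\<And>t. t < T \<Longrightarrow> density d (\<rho> t)"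
begin

lemma psd_tensor_density: "psd (d ^ T) (tensor_prod d T \<rho>)"
  by (rule psd_tensor[OF d density_psd[OF dens]])

lemma mat_trace_tensor_density: "mat_trace (d ^ T) (tensor_prod d T \<rho>) = 1"
  using mat_trace_tensor[OF d] density_trace[OF dens] by simp

text \<open>The swap trick: untouched factors contribute their trace 1, and at s and t the matrix
  units pick out entries whose sum over a and b is again a trace.\<close>

lemma trace2_swap_op:
  assumes "s < T" "t < T" "s \<noteq> t"
  shows "trace2 (d ^ T) (swap_op d T s t) (tensor_prod d T \<rho>) = trace2 d (\<rho> s) (\<rho> t)"
proof -
  have "trace2 (d ^ T) (swap_op d T s t) (tensor_prod d T \<rho>)
      = (\<Sum>a<d. \<Sum>b<d. \<Prod>u<T. trace2 d (swap_factor s t a b u) (\<rho> u))"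
    using \<open>s \<noteq> t\<close> d by (simp add: swap_op_def trace2_sum_left trace2_tensor)
  also have "\<dots> = (\<Sum>a<d. \<Sum>b<d. \<Prod>u\<in>{s, t}. trace2 d (swap_factor s t a b u) (\<rho> u))"
    using assms density_trace[OF dens]
    by (intro sum.cong refl prod.mono_neutral_right) (auto simp: swap_factor_def trace2_mat_id)
  also have "\<dots> = (\<Sum>a<d. \<Sum>b<d. \<rho> s b a * \<rho> t a b)"
    using \<open>s \<noteq> t\<close> by (intro sum.cong refl) (simp add: swap_factor_def trace2_unit_mat)
  also have "\<dots> = trace2 d (\<rho> s) (\<rho> t)"
    unfolding trace2_def by (rule sum.swap)
  finally show ?thesis .
qed

text \<open>Positions outside both swaps contribute trace 1. Writing the remaining positions as a
  set lets the product shrink when the pairs overlap, so one formula serves all overlap patterns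
  below.\<close>

lemma trace3_swap_op:
  assumes "s < T" "t < T" "u < T" "v < T" "s \<noteq> t" "u \<noteq> v"
  shows "trace3 (d ^ T) (swap_op d T s t) (swap_op d T u v) (tensor_prod d T \<rho>)
    = (\<Sum>a<d. \<Sum>b<d. \<Sum>a'<d. \<Sum>b'<d. \<Prod>w\<in>{s, t, u, v}.
        trace3 d (swap_factor s t a b w) (swap_factor u v a' b' w) (\<rho> w))"
proof -
  have "trace3 (d ^ T) (swap_op d T s t) (swap_op d T u v) (tensor_prod d T \<rho>)
      = (\<Sum>a<d. \<Sum>b<d. \<Sum>a'<d. \<Sum>b'<d. \<Prod>w<T.
        trace3 d (swap_factor s t a b w) (swap_factor u v a' b' w) (\<rho> w))"
    using assms d by (simp add: swap_op_def trace3_sum_1 trace3_sum_2 trace3_tensor)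
  also have "\<dots> = (\<Sum>a<d. \<Sum>b<d. \<Sum>a'<d. \<Sum>b'<d. \<Prod>w\<in>{s, t, u, v}.
        trace3 d (swap_factor s t a b w) (swap_factor u v a' b' w) (\<rho> w))"
    using assms density_trace[OF dens]
    by (intro sum.cong refl prod.mono_neutral_right)
      (auto simp: swap_factor_def trace3_mat_id_1 trace2_mat_id)
  finally show ?thesis .
qed

text \<open>At each of the four positions one of the two operators acts as the identity, so the sums
  over (a, b) and (a', b') separate.\<close>

lemma trace3_swap_op_disjoint:
  assumes "s < T" "t < T" "u < T" "v < T" "s \<noteq> t" "u \<noteq> v" "s \<noteq> u" "s \<noteq> v" "t \<noteq> u" "t \<noteq> v"
  shows "trace3 (d ^ T) (swap_op d T s t) (swap_op d T u v) (tensor_prod d T \<rho>)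
    = trace2 d (\<rho> s) (\<rho> t) * trace2 d (\<rho> u) (\<rho> v)"
proof -
  have "trace3 (d ^ T) (swap_op d T s t) (swap_op d T u v) (tensor_prod d T \<rho>)
      = (\<Sum>a<d. \<Sum>b<d. \<Sum>a'<d. \<Sum>b'<d. (\<rho> s b a * \<rho> t a b) * (\<rho> u b' a' * \<rho> v a' b'))"
    unfolding trace3_swap_op[OF assms(1-6)] using assms
    by (intro sum.cong refl) (simp add: swap_factor_def trace3_mat_id_1 trace3_mat_id_2
        trace2_unit_mat mult.assoc)
  also have "\<dots> = (\<Sum>a<d. \<Sum>b<d. \<rho> s b a * \<rho> t a b) * (\<Sum>a'<d. \<Sum>b'<d. \<rho> u b' a' * \<rho> v a' b')"
    by (simp only: sum_distrib_right, simp only: sum_distrib_left)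
  also have "(\<Sum>a<d. \<Sum>b<d. \<rho> s b a * \<rho> t a b) = trace2 d (\<rho> s) (\<rho> t)"
    unfolding trace2_def by (rule sum.swap)
  also have "(\<Sum>a<d. \<Sum>b<d. \<rho> u b a * \<rho> v a b) = trace2 d (\<rho> u) (\<rho> v)"
    unfolding trace2_def by (rule sum.swap)
  finally show ?thesis .
qed

text \<open>The product of two swaps with one common index is a 3-cycle of tensor factors, whose
  expectation is the trace of the three states in cyclic order.\<close>

lemma trace3_swap_op_overlap:
  assumes "s < T" "t < T" "v < T" "s \<noteq> t" "t \<noteq> v" "s \<noteq> v"
  shows "trace3 (d ^ T) (swap_op d T s t) (swap_op d T t v) (tensor_prod d T \<rho>)
    = trace3 d (\<rho> s) (\<rho> v) (\<rho> t)"
proof -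
  have "trace3 (d ^ T) (swap_op d T s t) (swap_op d T t v) (tensor_prod d T \<rho>)
      = (\<Sum>a<d. \<Sum>b<d. \<Sum>a'<d. \<Sum>b'<d. if a' = a then \<rho> s b a * \<rho> v a b' * \<rho> t b' b else 0)"
    unfolding trace3_swap_op[OF assms(1,2,2,3,4,5)] using assms
    by (intro sum.cong refl) (auto simp: swap_factor_def trace3_mat_id_1 trace3_mat_id_2
        trace2_unit_mat trace3_unit_mat)
  also have "\<dots> = (\<Sum>a<d. \<Sum>b<d. \<Sum>b'<d. \<Sum>a'<d.
      if a' = a then \<rho> s b a * \<rho> v a b' * \<rho> t b' b else 0)"
    by (rule sum.cong[OF refl], rule sum.cong[OF refl], rule sum.swap)
  also have "\<dots> = (\<Sum>a<d. \<Sum>b<d. \<Sum>b'<d. \<rho> s b a * \<rho> v a b' * \<rho> t b' b)"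
    by (intro sum.cong refl) simp
  also have "\<dots> = trace3 d (\<rho> s) (\<rho> v) (\<rho> t)"
    unfolding trace3_def by (rule sum.swap)
  finally show ?thesis .
qed

text \<open>A swap is an involution, so the value is the trace of the state itself.\<close>

lemma trace3_swap_op_square:
  assumes "s < T" "t < T" "s \<noteq> t"
  shows "trace3 (d ^ T) (swap_op d T s t) (swap_op d T s t) (tensor_prod d T \<rho>) = 1"
proof -
  have "{s, t, s, t} = {s, t}" by auto
  then have "trace3 (d ^ T) (swap_op d T s t) (swap_op d T s t) (tensor_prod d T \<rho>)
      = (\<Sum>a<d. \<Sum>b<d. \<Sum>a'<d. \<Sum>b'<d. if b' = a then if a' = b then \<rho> s a a * \<rho> t b b else 0 else 0)"
    unfolding trace3_swap_op[OF assms(1,2,1,2,3,3)] using assms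
    by (intro sum.cong refl) (auto simp: swap_factor_def trace3_unit_mat)
  also have "\<dots> = (\<Sum>a<d. \<Sum>b<d. \<rho> s a a * \<rho> t b b)"
    by (intro sum.cong refl) simp
  also have "\<dots> = mat_trace d (\<rho> s) * mat_trace d (\<rho> t)"
    by (simp add: mat_trace_def sum_product)
  finally show ?thesis
    using assms density_trace[OF dens] by simp
qed

text \<open>\<open>trace3_abs_le\<close> reduces this to squares of swaps, whose expectation is 1,
  or 0 if the indices coincide.\<close>

lemma trace3_swap_op_abs_le:
  assumes "s < T" "t < T" "u < T" "v < T"
  shows "\<bar>Re (trace3 (d ^ T) (swap_op d T s t) (swap_op d T u v) (tensor_prod d T \<rho>))\<bar> \<le> 1"
proof -
  have "Re (trace3 (d ^ T) (swap_op d T s t) (swap_op d T s t) (tensor_prod d T \<rho>)) \<le> 1"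
    if "s < T" "t < T" for s t
    using trace3_swap_op_square[OF that] by (cases "s = t") (simp_all add: swap_op_self trace3_def)
  from this[OF assms(1,2)] this[OF assms(3,4)] show ?thesis
    using trace3_abs_le[OF hermitian_swap_op hermitian_swap_op psd_tensor_density,
        of d T s t d T u v] by linarith
qed

text \<open>The same Cauchy-Schwarz bound, with the identity as second operator.\<close>

lemma trace2_swap_op_abs_le:
  assumes "s < T" "t < T" "s \<noteq> t"
  shows "\<bar>Re (trace2 (d ^ T) (swap_op d T s t) (tensor_prod d T \<rho>))\<bar> \<le> 1"
proof -
  have "hermitian (d ^ T) mat_id"
    by (simp add: hermitian_def mat_id_def)
  from trace3_abs_le[OF hermitian_swap_op this psd_tensor_density, of d T s t] show ?thesis
    using trace3_swap_op_square[OF assms] mat_trace_tensor_density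
    by (simp add: trace3_mat_id_1 trace3_mat_id_2 trace2_mat_id)
qed

end

lemma density_trace2_nonneg:
  "density d A \<Longrightarrow> density d B \<Longrightarrow> 0 \<le> Re (trace2 d A B)"
  by (simp add: density_psd trace2_psd_nonneg)

lemma density_dim_pos: "density d A \<Longrightarrow> d > 0"
  using density_trace[of d A] by (cases d) (auto simp: mat_trace_def)

text \<open>The traces in the next two lemmas are expectations of products of swaps in a two- or
  three-fold tensor product.\<close>
lemma density_trace2_le_1:
  assumes "density d A" "density d B"
  shows "Re (trace2 d A B) \<le> 1"
proof -
  let ?r = "\<lambda>t::nat. if t = 0 then A else B"
  have r: "density d (?r t)" if "t < 2" for t
    using assms by simp
  show ?thesis
    using trace2_swap_op[OF density_dim_pos[OF assms(1)], of 2 ?r 0 1, OF r]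
      trace2_swap_op_abs_le[OF density_dim_pos[OF assms(1)], of 2 ?r 0 1, OF r]
    by simp
qed

lemma density_trace3_abs_le_1:
  assumes "density d A" "density d B" "density d C"
  shows "\<bar>Re (trace3 d A B C)\<bar> \<le> 1"
proof -
  \<comment> \<open>\<open>C\<close> precedes \<open>B\<close> because the overlap formula for
    positions 0, 1, 2 multiplies the states in the order 0, 2, 1.\<close>
  let ?r = "\<lambda>t::nat. if t = 0 then A else if t = 1 then C else B"
  have r: "density d (?r t)" if "t < 3" for t
    using assms by simp
  show ?thesis
    using trace3_swap_op_overlap[OF density_dim_pos[OF assms(1)], of 3 ?r 0 1 2, OF r]
      trace3_swap_op_abs_le[OF density_dim_pos[OF assms(1)], of 3 ?r 0 1 1 2, OF r]
    by simp
qed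

section \<open>Threshold measurements\<close>

text \<open>Measuring X in its eigenbasis yields a random eigenvalue whose first two moments are the
  traces in the bounds, so both bounds are Chebyshev's inequality. The effect is fixed before the
  state is chosen, so one measurement serves all states.\<close>

lemma threshold_measurement:
  assumes X: "hermitian n X"
  obtains M where "effect n M"
    "\<And>\<omega>. psd n \<omega> \<Longrightarrow> mat_trace n \<omega> = 1 \<Longrightarrow> Re (trace2 n X \<omega>) < c \<Longrightarrow>
      accept_prob n M \<omega> \<ge> 1 - (Re (trace3 n X X \<omega>) - (Re (trace2 n X \<omega>))\<^sup>2) / (c - Re (trace2 n X \<omega>))\<^sup>2"
    "\<And>\<omega>. psd n \<omega> \<Longrightarrow> mat_trace n \<omega> = 1 \<Longrightarrow> Re (trace2 n X \<omega>) > c \<Longrightarrow>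
      accept_prob n M \<omega> \<le> (Re (trace3 n X X \<omega>) - (Re (trace2 n X \<omega>))\<^sup>2) / (c - Re (trace2 n X \<omega>))\<^sup>2"
proof -
  obtain v l where v: "orthonormal_family n n v"
    and Xv: "\<And>i j. i < n \<Longrightarrow> j < n \<Longrightarrow> X i j = (\<Sum>k<n. complex_of_real (l k) * (v k i * cnj (v k j)))"
    using spectral_decomposition[OF X] by metis
  define P where "P = (\<lambda>k i j. v k i * cnj (v k j))"
  define M where "M = (\<lambda>i j. \<Sum>k | k < n \<and> l k \<le> c. P k i j)"
  have id: "mat_id i j = (\<Sum>k<n. P k i j)" if "i < n" "j < n" for i j
    using orthonormal_basis_complete[OF v that] by (simp add: P_def)
  have split: "(\<Sum>k<n. f k) = (\<Sum>k | k < n \<and> l k \<le> c. f k) + (\<Sum>k | k < n \<and> \<not> l k \<le> c. f k)"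
    for f :: "nat \<Rightarrow> 'a::comm_monoid_add"
    by (subst sum.union_disjoint[symmetric]) (auto intro!: sum.cong)
  have "psd n M"
    by (rule psd_gram) (simp add: M_def P_def)
  moreover have "psd n (\<lambda>i j. mat_id i j - M i j)"
  proof (rule psd_gram)
    fix i j assume "i < n" "j < n"
    then show "mat_id i j - M i j = (\<Sum>k | k < n \<and> \<not> l k \<le> c. v k i * cnj (v k j))"
      using split[of "\<lambda>k. P k i j"] by (simp add: id M_def P_def)
  qed
  ultimately have "effect n M" by (simp add: effect_def)
  \<comment> \<open>Orthonormality removes the cross terms: X^2 has the eigenprojections of X with
    squared eigenvalues.\<close>
  have XX: "mat_mult n X X i j = (\<Sum>k<n. complex_of_real ((l k)\<^sup>2) * P k i j)" if "i < n" "j < n" for i j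
  proof -
    have "mat_mult n X X i j = (\<Sum>x<n. (\<Sum>a<n. of_real (l a) * (v a i * cnj (v a x)))
        * (\<Sum>b<n. of_real (l b) * (v b x * cnj (v b j))))"
      unfolding mat_mult_def using that Xv by (intro sum.cong refl) auto
    also have "\<dots> = (\<Sum>x<n. \<Sum>a<n. \<Sum>b<n.
        of_real (l a) * of_real (l b) * v a i * cnj (v b j) * (cnj (v a x) * v b x))"
      unfolding sum_product by (simp add: mult_ac)
    also have "\<dots> = (\<Sum>a<n. \<Sum>b<n.
        of_real (l a) * of_real (l b) * v a i * cnj (v b j) * cinner n (v a) (v b))"
      unfolding cinner_def sum_distrib_left
      by (subst sum.swap, rule sum.cong[OF refl], rule sum.swap)
    also have "\<dots> = (\<Sum>a<n. \<Sum>b<n. if b = a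
        then of_real (l a) * of_real (l b) * v a i * cnj (v b j) else 0)"
      using v unfolding orthonormal_family_def by (intro sum.cong refl) auto
    finally show ?thesis
      by (simp add: P_def power2_eq_square mult.assoc)
  qed
  have *: "(Re (trace2 n X \<omega>) < c \<longrightarrow>
      accept_prob n M \<omega> \<ge> 1 - (Re (trace3 n X X \<omega>) - (Re (trace2 n X \<omega>))\<^sup>2) / (c - Re (trace2 n X \<omega>))\<^sup>2) \<and>
    (Re (trace2 n X \<omega>) > c \<longrightarrow>
      accept_prob n M \<omega> \<le> (Re (trace3 n X X \<omega>) - (Re (trace2 n X \<omega>))\<^sup>2) / (c - Re (trace2 n X \<omega>))\<^sup>2)"
    if \<omega>: "psd n \<omega>" "mat_trace n \<omega> = 1" for \<omega>
  proof -
    define p where "p = (\<lambda>k. Re (trace2 n (P k) \<omega>))"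
    define m where "m = Re (trace2 n X \<omega>)"
    define V where "V = Re (trace3 n X X \<omega>) - m\<^sup>2"
    have p0: "p k \<ge> 0" for k
      unfolding p_def by (intro trace2_psd_nonneg psd_gram[where I = "{k}" and w = v] \<omega>(1))
        (simp add: P_def)
    have "trace2 n mat_id \<omega> = trace2 n (\<lambda>i j. \<Sum>k<n. P k i j) \<omega>"
      using id by (intro trace2_cong) auto
    then have p1: "(\<Sum>k<n. p k) = 1"
      using \<omega>(2) by (simp add: trace2_mat_id trace2_sum_left p_def flip: Re_sum)
    have lin: "Re (trace2 n Y \<omega>) = (\<Sum>k<n. f k * p k)"
      if "\<And>i j. i < n \<Longrightarrow> j < n \<Longrightarrow> Y i j = (\<Sum>k<n. of_real (f k) * P k i j)" for Y f
    proof -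
      have "trace2 n Y \<omega> = trace2 n (\<lambda>i j. \<Sum>k<n. of_real (f k) * P k i j) \<omega>"
        using that by (intro trace2_cong) auto
      then show ?thesis
        by (simp add: trace2_sum_left trace2_scale_left p_def)
    qed
    have m: "m = (\<Sum>k<n. l k * p k)"
      unfolding m_def by (rule lin) (simp add: Xv P_def)
    have m2: "Re (trace3 n X X \<omega>) = (\<Sum>k<n. (l k)\<^sup>2 * p k)"
      unfolding trace2_mat_mult[symmetric] by (rule lin) (rule XX)
    have V: "V = (\<Sum>k<n. (l k - m)\<^sup>2 * p k)"
    proof -
      have "(\<Sum>k<n. (l k - m)\<^sup>2 * p k)
          = (\<Sum>k<n. (l k)\<^sup>2 * p k) - 2 * m * (\<Sum>k<n. l k * p k) + m\<^sup>2 * (\<Sum>k<n. p k)"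
        by (simp add: power2_diff algebra_simps sum.distrib sum_subtractf sum_distrib_left sum_distrib_right)
      then show ?thesis
        by (simp add: V_def m2 p1 m[symmetric] power2_eq_square)
    qed
    \<comment> \<open>Chebyshev for a set S of outcomes at distance at least |c - m| from the mean:
      on S the weight in the variance is at least (c - m)^2.\<close>
    have cheb: "(\<Sum>k\<in>S. p k) \<le> V / (c - m)\<^sup>2"
      if "S \<subseteq> {..<n}" "\<And>k. k \<in> S \<Longrightarrow> (c - m)\<^sup>2 \<le> (l k - m)\<^sup>2" "c \<noteq> m" for S
    proof -
      have "(c - m)\<^sup>2 * (\<Sum>k\<in>S. p k) \<le> (\<Sum>k\<in>S. (l k - m)\<^sup>2 * p k)"
        unfolding sum_distrib_left using that(2) p0 by (intro sum_mono mult_right_mono)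
      also have "\<dots> \<le> V"
        unfolding V using that(1) p0 by (intro sum_mono2) auto
      finally show ?thesis
        using that(3) by (simp add: field_simps)
    qed
    have acc: "accept_prob n M \<omega> = (\<Sum>k | k < n \<and> l k \<le> c. p k)"
      by (simp add: accept_prob_def mat_trace_mult M_def trace2_sum_left p_def)
    have "1 - V / (c - m)\<^sup>2 \<le> accept_prob n M \<omega>" if "m < c"
    proof -
      have "(\<Sum>k | k < n \<and> \<not> l k \<le> c. p k) \<le> V / (c - m)\<^sup>2"
        using that by (intro cheb) (auto intro!: power_mono)
      then show ?thesis
        using split[of p] p1 acc by linarith
    qed
    moreover have "accept_prob n M \<omega> \<le> V / (c - m)\<^sup>2" if "m > c"
    proof -
      have "(c - m)\<^sup>2 \<le> (l k - m)\<^sup>2" if "l k \<le> c" for k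
        unfolding power2_commute[of _ m] using that \<open>m > c\<close> by (intro power_mono) auto
      then show ?thesis
        unfolding acc using that by (intro cheb) auto
    qed
    ultimately show ?thesis
      by (simp add: V_def m_def)
  qed
  show ?thesis
    by (rule that[OF \<open>effect n M\<close>]) (use * in blast)+
qed

section \<open>Distance to the maximally mixed state\<close>

text \<open>In operator terms, A <= I. The normalised matrix w w^H / |w|^2 is itself a density
  matrix, so \<open>density_trace2_le_1\<close> applies to it.\<close>

lemma density_quadratic_form_le:
  assumes "density d A"
  shows "Re (trace2 d A (\<lambda>i j. w i * cnj (w j))) \<le> (\<Sum>i<d. (cmod (w i))\<^sup>2)"
proof (cases "(\<Sum>i<d. (cmod (w i))\<^sup>2) = 0")
  case True
  then have "w i = 0" if "i < d" for i
    using cinner_self_eq_0[of d w i] that by (simp add: cinner_self)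
  then show ?thesis
    by (simp add: trace2_def)
next
  case False
  define s where "s = (\<Sum>i<d. (cmod (w i))\<^sup>2)"
  have "s > 0"
    using False by (simp add: s_def sum_nonneg less_le)
  define B where "B = (\<lambda>i j. of_real (1 / s) * (w i * cnj (w j)))"
  have "psd d B"
    by (rule psd_gram[where I = "{0}" and w = "\<lambda>_ i. of_real (sqrt (1 / s)) * w i"])
      (use \<open>s > 0\<close> in \<open>simp add: B_def field_simps flip: of_real_mult\<close>)
  moreover have "mat_trace d B = 1"
  proof -
    have "mat_trace d B = of_real (1 / s) * cinner d w w"
      by (simp add: mat_trace_def B_def cinner_def sum_distrib_left mult_ac)
    also have "\<dots> = of_real (1 / s * s)"
      unfolding cinner_self s_def[symmetric] by simp
    finally show ?thesis using \<open>s > 0\<close> by simp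
  qed
  ultimately have "density d B" by (simp add: density_def)
  then have "Re (trace2 d A B) \<le> 1"
    by (rule density_trace2_le_1[OF assms])
  also have "trace2 d A B = of_real (1 / s) * trace2 d A (\<lambda>i j. w i * cnj (w j))"
    by (simp only: B_def trace2_scale_left trace2_commute[of d A])
  finally have "1 / s * Re (trace2 d A (\<lambda>i j. w i * cnj (w j))) \<le> 1"
    by (simp only: Re_complex_of_real_mult)
  then show ?thesis
    using \<open>s > 0\<close> by (simp add: s_def[symmetric] field_simps)
qed

text \<open>B^2 is the sum of b_k b_k^H over the columns b_k of B, and A <= I bounds each
  contribution b_k^H A b_k by |b_k|^2.\<close>

lemma density_trace3_square_le:
  assumes "density d A" "hermitian d B"
  shows "Re (trace3 d A B B) \<le> Re (trace2 d B B)"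
proof -
  have "trace3 d A B B = trace2 d A (mat_mult d B B)"
    by (metis trace2_commute trace2_mat_mult trace3_rotate)
  also have "\<dots> = trace2 d A (\<lambda>i j. \<Sum>k<d. B i k * cnj (B j k))"
    by (intro trace2_cong refl) (simp add: mat_mult_def hermitian_cnj[OF assms(2)])
  also have "\<dots> = (\<Sum>k<d. trace2 d A (\<lambda>i j. B i k * cnj (B j k)))"
    by (rule trace2_sum_right)
  finally have "Re (trace3 d A B B) \<le> (\<Sum>k<d. \<Sum>i<d. (cmod (B i k))\<^sup>2)"
    by (simp add: sum_mono density_quadratic_form_le[OF assms(1)])
  also have "(\<Sum>k<d. \<Sum>i<d. (cmod (B i k))\<^sup>2) = Re (trace2 d B B)"
  proof -
    have "trace2 d B B = (\<Sum>k<d. \<Sum>i<d. cnj (B i k) * B i k)"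
      by (simp add: trace2_def hermitian_cnj[OF assms(2)])
    also have "\<dots> = (\<Sum>k<d. of_real (\<Sum>i<d. (cmod (B i k))\<^sup>2))"
      unfolding cinner_self[symmetric] by (simp add: cinner_def)
    finally show ?thesis by simp
  qed
  finally show ?thesis .
qed

lemma psd_mat_id: "psd n mat_id"
proof (rule psd_gram)
  fix i j assume "i < n" "j < n"
  have "(\<Sum>k<n. mat_id k i * cnj (mat_id k j)) = (\<Sum>k<n. if k = i then mat_id i j else 0)"
    by (intro sum.cong refl) (simp add: mat_id_def)
  then show "mat_id i j = (\<Sum>k<n. mat_id k i * cnj (mat_id k j))"
    using \<open>i < n\<close> by simp
qed

lemma hs_dist_max_mixed:
  assumes "density d A"
  shows "hs_dist_sq d A (max_mixed d) = Re (trace2 d A A) - 1 / real d"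
    and "0 \<le> hs_dist_sq d A (max_mixed d)"
    and "Re (trace3 d A A A) - (Re (trace2 d A A))\<^sup>2 \<le> hs_dist_sq d A (max_mixed d)"
proof -
  define B where "B = (\<lambda>i j. A i j + of_real (- 1 / real d) * mat_id i j)"
  have "d > 0" using density_dim_pos[OF assms] .
  have AB: "(\<lambda>i j. A i j - max_mixed d i j) = B"
    by (simp add: B_def max_mixed_def)
  have "hermitian d B"
    unfolding hermitian_def
    by (simp add: B_def mat_id_def hermitian_cnj[OF density_hermitian[OF assms]])
  have tr: "mat_trace d A = 1" "mat_trace d mat_id = of_nat d"
    using density_trace[OF assms] by (simp_all add: mat_trace_def mat_id_def)
  have hs: "hs_dist_sq d A (max_mixed d) = Re (trace2 d B B)"
    by (simp add: hs_dist_sq_def mat_trace_mult AB)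
  have "trace2 d B B = trace3 d B B mat_id"
    by (metis trace3_mat_id_1 trace3_rotate)
  also have "\<dots> = trace2 d A A - of_real (1 / real d)"
    unfolding B_def trace3_add_1 trace3_add_2 trace3_scale_1 trace3_scale_2
    using \<open>d > 0\<close> by (simp add: trace3_mat_id_1 trace3_mat_id_2 trace2_mat_id tr field_simps
      trace3_rotate[of d A A] trace2_commute[of d A mat_id])
  finally show dist: "hs_dist_sq d A (max_mixed d) = Re (trace2 d A A) - 1 / real d"
    by (simp add: hs)
  have "0 \<le> Re (trace3 d B B mat_id)"
    using \<open>hermitian d B\<close> psd_mat_id by (rule trace3_square_nonneg)
  then show "0 \<le> hs_dist_sq d A (max_mixed d)"
    by (simp add: hs \<open>trace2 d B B = trace3 d B B mat_id\<close>)
  have "trace3 d A B B = trace3 d B B A"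
    by (rule trace3_rotate)
  also have "\<dots> = trace3 d A A A - of_real (2 / real d) * trace2 d A A + of_real (1 / (real d)\<^sup>2)"
    unfolding B_def trace3_add_1 trace3_add_2 trace3_scale_1 trace3_scale_2
    using \<open>d > 0\<close> by (simp add: trace3_mat_id_1 trace3_mat_id_2 trace2_mat_id tr field_simps
      power2_eq_square)
  finally have "Re (trace3 d A B B)
      = Re (trace3 d A A A) - 2 / real d * Re (trace2 d A A) + 1 / (real d)\<^sup>2"
    by (simp only: Re_complex_of_real_mult minus_complex.sel plus_complex.sel Re_complex_of_real)
  \<comment> \<open>The excess of Tr(A B^2) over Tr A^3 - (Tr A^2)^2 is exactly this square, which
    is then dropped.\<close>
  moreover have "(Re (trace2 d A A) - 1 / real d)\<^sup>2
      = (Re (trace2 d A A))\<^sup>2 - 2 / real d * Re (trace2 d A A) + 1 / (real d)\<^sup>2"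
    by (simp add: power2_diff power_divide)
  ultimately have "Re (trace3 d A A A) - (Re (trace2 d A A))\<^sup>2 \<le> Re (trace3 d A B B)"
    using zero_le_power2[of "Re (trace2 d A A) - 1 / real d"] by linarith
  also have "\<dots> \<le> Re (trace2 d B B)"
    by (rule density_trace3_square_le[OF assms \<open>hermitian d B\<close>])
  finally show "Re (trace3 d A A A) - (Re (trace2 d A A))\<^sup>2 \<le> hs_dist_sq d A (max_mixed d)"
    by (simp add: hs)
qed

section \<open>Mean and variance of the swap statistic\<close>

text \<open>For distinct x, y, z this is the covariance of the swaps of (x, y) and (y, z).\<close>
definition cov3 :: "nat \<Rightarrow> (nat \<Rightarrow> nat \<Rightarrow> nat \<Rightarrow> complex) \<Rightarrow> nat \<Rightarrow> nat \<Rightarrow> nat \<Rightarrow> real" where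
  "cov3 d \<rho> x y z = Re (trace3 d (\<rho> x) (\<rho> y) (\<rho> z))
     - Re (trace2 d (\<rho> x) (\<rho> y)) * Re (trace2 d (\<rho> y) (\<rho> z))"

text \<open>With T^2 in place of T (T - 1), full sums over all indices become powers of rho_avg; the
  missing diagonal costs a bias of at most 1/T, which is small against theta.\<close>

definition swap_stat :: "nat \<Rightarrow> nat \<Rightarrow> nat \<Rightarrow> nat \<Rightarrow> complex" where
  "swap_stat d T = (\<lambda>i j. of_real (1 / (real T)\<^sup>2) * (\<Sum>s<T. \<Sum>t<T. swap_op d T s t i j))"

lemma hermitian_swap_stat: "hermitian n (swap_stat d T)"
proof -
  have "cnj (swap_op d T s t j i) = swap_op d T s t i j" for s t i j
    \<comment> \<open>\<open>hermitian\<close> speaks only of indices below the dimension; a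
      dimension exceeding both i and j gives the identity at every entry.\<close>
    using hermitian_cnj[OF hermitian_swap_op, of j "Suc (max i j)" i] by simp
  then show ?thesis
    by (simp add: hermitian_def swap_stat_def)
qed

context
  fixes d T :: nat and \<rho> :: "nat \<Rightarrow> nat \<Rightarrow> nat \<Rightarrow> complex"
  assumes d: "d > 0" and T: "T > 0" and dens: "\<And>t. t < T \<Longrightarrow> density d (\<rho> t)"
begin

lemma cov3_ge:
  assumes "x < T" "y < T" "z < T"
  shows "cov3 d \<rho> x y z \<ge> -2"
proof -
  have "Re (trace2 d (\<rho> x) (\<rho> y)) * Re (trace2 d (\<rho> y) (\<rho> z)) \<le> 1"
    using assms dens by (intro mult_le_one density_trace2_le_1 density_trace2_nonneg) auto
  moreover have "\<bar>Re (trace3 d (\<rho> x) (\<rho> y) (\<rho> z))\<bar> \<le> 1"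
    using assms dens by (intro density_trace3_abs_le_1) auto
  ultimately show ?thesis
    unfolding cov3_def by linarith
qed

text \<open>Expectations in the product state of one swap and of a product of two; the digit counts
  the tensor indices.\<close>

abbreviation "swap2 s t \<equiv> Re (trace2 (d ^ T) (swap_op d T s t) (tensor_prod d T \<rho>))"
abbreviation "swap4 s t u v \<equiv> Re (trace3 (d ^ T) (swap_op d T s t) (swap_op d T u v) (tensor_prod d T \<rho>))"

lemma swap2_eq:
  assumes "s < T" "t < T"
  shows "swap2 s t = (if s = t then 0 else Re (trace2 d (\<rho> s) (\<rho> t)))"
proof (cases "s = t")
  case True
  then show ?thesis by (simp add: swap_op_self trace2_def)
next
  case False
  with trace2_swap_op[OF d, of T \<rho>, OF dens assms] show ?thesis by simp
qed

text \<open>The 3-cycle yields the order s, v, t; reversal and rotation of the real part bring the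
  shared index into the middle, where \<open>cov3\<close> has it.\<close>

lemma swap4_overlap:
  assumes "s < T" "t < T" "v < T" "s \<noteq> t" "t \<noteq> v" "s \<noteq> v"
  shows "swap4 s t t v - swap2 s t * swap2 t v = cov3 d \<rho> s t v"
proof -
  have "Re (trace3 d (\<rho> s) (\<rho> v) (\<rho> t)) = Re (trace3 d (\<rho> t) (\<rho> v) (\<rho> s))"
    using assms dens by (intro Re_trace3_reverse density_hermitian)
  also have "\<dots> = Re (trace3 d (\<rho> s) (\<rho> t) (\<rho> v))"
    using trace3_rotate by metis
  finally show ?thesis
    using trace3_swap_op_overlap[OF d, of T \<rho>, OF dens assms] assms by (simp add: swap2_eq cov3_def)
qed

text \<open>Swaps of disjoint pairs are uncorrelated and swaps of pairs with one common index have
  covariance cov3. If two of the four equalities hold, the left side is at most 1 and the four cov3 terms add up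
  to at least -8, so the error term 10 suffices; only order T^2 quadruples are of this kind.\<close>
lemma swap_covariance_le:
  assumes "s < T" "t < T" "u < T" "v < T"
  shows "swap4 s t u v - swap2 s t * swap2 u v
    \<le> (if s = u then cov3 d \<rho> t s v else 0) + (if s = v then cov3 d \<rho> t s u else 0)
    + (if t = u then cov3 d \<rho> s t v else 0) + (if t = v then cov3 d \<rho> s t u else 0)
    + 10 * ((if s = u then if s = v then 1 else 0 else 0) + (if s = u then if t = u then 1 else 0 else 0)
      + (if s = u then if t = v then 1 else 0 else 0)
      + (if s = v then if t = u then 1 else 0 else 0) + (if s = v then if t = v then 1 else 0 else 0)
      + (if t = u then if t = v then 1 else 0 else 0))"
    (is "?F \<le> ?R")
proof -
  have nonneg: "swap2 x y \<ge> 0" if "x < T" "y < T" for x y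
    using that dens by (auto simp: swap2_eq intro: density_trace2_nonneg)
  have zero: "?F = 0" if "s = t \<or> u = v"
    using that by (auto simp: swap_op_self trace2_def trace3_def)
  \<comment> \<open>The subtracted product of means is nonnegative, so the bound on the product of
    two swaps suffices.\<close>
  have "?F \<le> 1"
    using trace3_swap_op_abs_le[OF d, of T \<rho>, OF dens assms] mult_nonneg_nonneg[OF nonneg nonneg, of s t u v] assms
    by linarith
  have c: "(if b then cov3 d \<rho> x y z else 0) \<ge> -2" if "x < T" "y < T" "z < T" for b x y z
    using cov3_ge[OF that] by simp
  have sum_ge: "-8 \<le> (if s = u then cov3 d \<rho> t s v else 0) + (if s = v then cov3 d \<rho> t s u else 0)
    + (if t = u then cov3 d \<rho> s t v else 0) + (if t = v then cov3 d \<rho> s t u else 0)"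
    using c[of t s v "s = u"] c[of t s u "s = v"] c[of s t v "t = u"] c[of s t u "t = v"] assms
    by linarith
  \<comment> \<open>Cases by the number of equalities between {s, t} and {u, v}. Where exactly one
    holds, the listed inequalities force s and t, and u and v, to be distinct, so
    \<open>swap4_overlap\<close> applies.\<close>
  consider (two) "(s = u \<and> s = v) \<or> (s = u \<and> t = u) \<or> (s = u \<and> t = v)
      \<or> (s = v \<and> t = u) \<or> (s = v \<and> t = v) \<or> (t = u \<and> t = v)"
    | (none) "s \<noteq> u" "s \<noteq> v" "t \<noteq> u" "t \<noteq> v"
    | (su) "s = u" "s \<noteq> v" "t \<noteq> u" "t \<noteq> v"
    | (sv) "s = v" "s \<noteq> u" "t \<noteq> u" "t \<noteq> v"
    | (tu) "t = u" "s \<noteq> u" "s \<noteq> v" "t \<noteq> v"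
    | (tv) "t = v" "s \<noteq> u" "s \<noteq> v" "t \<noteq> u"
    by blast
  then show ?thesis
  proof cases
    case two
    then have "(1::real) \<le> (if s = u then if s = v then 1 else 0 else 0) + (if s = u then if t = u then 1 else 0 else 0)
      + (if s = u then if t = v then 1 else 0 else 0)
      + (if s = v then if t = u then 1 else 0 else 0) + (if s = v then if t = v then 1 else 0 else 0)
      + (if t = u then if t = v then 1 else 0 else 0)"
      by (elim disjE) simp_all
    with \<open>?F \<le> 1\<close> sum_ge show ?thesis by argo
  next
    case none
    show ?thesis
    proof (cases "s = t \<or> u = v")
      case True
      with none zero show ?thesis by simp
    next
      case False
      have "swap4 s t u v = Re (trace2 d (\<rho> s) (\<rho> t) * trace2 d (\<rho> u) (\<rho> v))"
        using trace3_swap_op_disjoint[OF d, of T \<rho>, OF dens assms] False none by simp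
      also have "trace2 d (\<rho> s) (\<rho> t) = of_real (Re (trace2 d (\<rho> s) (\<rho> t)))"
        using assms dens by (intro trace2_hermitian_real density_hermitian)
      finally have "?F = 0"
        using False assms by (simp only: Re_complex_of_real_mult swap2_eq) simp
      with none show ?thesis by simp
    qed
  next
    case su
    with swap4_overlap[of t s v] assms show ?thesis unfolding swap_op_commute[of d T s t] by auto
  next
    case sv
    with swap4_overlap[of t s u] assms show ?thesis
      unfolding swap_op_commute[of d T s t] swap_op_commute[of d T u v] by auto
  next
    case tu
    with swap4_overlap[of s t v] assms show ?thesis by auto
  next
    case tv
    with swap4_overlap[of s t u] assms show ?thesis unfolding swap_op_commute[of d T u v] by auto
  qed
qed

text \<open>Each of the four single equalities leaves three free indices and gives one full sum of
  \<open>cov3\<close>. Each of the six double equalities leaves two free indices, hence T^2, and 6 *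
  10 = 60.\<close>

lemma swap_covariance_sum_le:
  "(\<Sum>s<T. \<Sum>t<T. \<Sum>u<T. \<Sum>v<T. swap4 s t u v - swap2 s t * swap2 u v)
    \<le> 4 * (\<Sum>y<T. \<Sum>x<T. \<Sum>z<T. cov3 d \<rho> x y z) + 60 * (real T)\<^sup>2"
proof -
  let ?C = "\<Sum>y<T. \<Sum>x<T. \<Sum>z<T. cov3 d \<rho> x y z"
  \<comment> \<open>A condition free of the innermost index moves outwards, so that the nested
    conditionals remove one summation index at a time.\<close>
  have pull: "(\<Sum>v<T. if b then f v else 0) = (if b then \<Sum>v<T. f v else 0)"
    for b and f :: "nat \<Rightarrow> real"
    by simp
  have "(\<Sum>s<T. \<Sum>t<T. \<Sum>u<T. \<Sum>v<T. swap4 s t u v - swap2 s t * swap2 u v)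
    \<le> (\<Sum>s<T. \<Sum>t<T. \<Sum>u<T. \<Sum>v<T.
      (if s = u then cov3 d \<rho> t s v else 0) + (if s = v then cov3 d \<rho> t s u else 0)
    + (if t = u then cov3 d \<rho> s t v else 0) + (if t = v then cov3 d \<rho> s t u else 0)
    + 10 * ((if s = u then if s = v then 1 else 0 else 0) + (if s = u then if t = u then 1 else 0 else 0)
      + (if s = u then if t = v then 1 else 0 else 0)
      + (if s = v then if t = u then 1 else 0 else 0) + (if s = v then if t = v then 1 else 0 else 0)
      + (if t = u then if t = v then 1 else 0 else 0)))"
    by (intro sum_mono swap_covariance_le) auto
  also have "\<dots> = (\<Sum>s<T. \<Sum>t<T. \<Sum>u<T. \<Sum>v<T. if s = u then cov3 d \<rho> t s v else 0)
    + (\<Sum>s<T. \<Sum>t<T. \<Sum>u<T. \<Sum>v<T. if s = v then cov3 d \<rho> t s u else 0)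
    + (\<Sum>s<T. \<Sum>t<T. \<Sum>u<T. \<Sum>v<T. if t = u then cov3 d \<rho> s t v else 0)
    + (\<Sum>s<T. \<Sum>t<T. \<Sum>u<T. \<Sum>v<T. if t = v then cov3 d \<rho> s t u else 0)
    + 10 * ((\<Sum>s<T. \<Sum>t<T. \<Sum>u<T. \<Sum>v<T. (if s = u then if s = v then 1 else 0 else 0))
      + (\<Sum>s<T. \<Sum>t<T. \<Sum>u<T. \<Sum>v<T. (if s = u then if t = u then 1 else 0 else 0))
      + (\<Sum>s<T. \<Sum>t<T. \<Sum>u<T. \<Sum>v<T. (if s = u then if t = v then 1 else 0 else 0))
      + (\<Sum>s<T. \<Sum>t<T. \<Sum>u<T. \<Sum>v<T. (if s = v then if t = u then 1 else 0 else 0))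
      + (\<Sum>s<T. \<Sum>t<T. \<Sum>u<T. \<Sum>v<T. (if s = v then if t = v then 1 else 0 else 0))
      + (\<Sum>s<T. \<Sum>t<T. \<Sum>u<T. \<Sum>v<T. (if t = u then if t = v then 1 else 0 else 0)))"
    by (simp only: sum.distrib sum_distrib_left distrib_left)
  also have "(\<Sum>s<T. \<Sum>t<T. \<Sum>u<T. \<Sum>v<T. if s = u then cov3 d \<rho> t s v else 0) = ?C"
    by (simp add: pull)
  also have "(\<Sum>s<T. \<Sum>t<T. \<Sum>u<T. \<Sum>v<T. if s = v then cov3 d \<rho> t s u else 0) = ?C"
    by simp
  also have "(\<Sum>s<T. \<Sum>t<T. \<Sum>u<T. \<Sum>v<T. if t = u then cov3 d \<rho> s t v else 0) = ?C"
    by (subst sum.swap) (simp add: pull)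
  also have "(\<Sum>s<T. \<Sum>t<T. \<Sum>u<T. \<Sum>v<T. if t = v then cov3 d \<rho> s t u else 0) = ?C"
    by (subst sum.swap) simp
  also have "(\<Sum>s<T. \<Sum>t<T. \<Sum>u<T. \<Sum>v<T. (if s = u then if s = v then 1 else 0 else 0)) = (real T)\<^sup>2"
    by (simp add: pull power2_eq_square flip: sum_distrib_left)
  also have "(\<Sum>s<T. \<Sum>t<T. \<Sum>u<T. \<Sum>v<T. (if s = u then if t = u then 1 else 0 else 0)) = (real T)\<^sup>2"
    by (simp add: pull power2_eq_square flip: sum_distrib_left)
  also have "(\<Sum>s<T. \<Sum>t<T. \<Sum>u<T. \<Sum>v<T. (if s = u then if t = v then 1 else 0 else 0)) = (real T)\<^sup>2"
    by (simp add: pull power2_eq_square flip: sum_distrib_left)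
  also have "(\<Sum>s<T. \<Sum>t<T. \<Sum>u<T. \<Sum>v<T. (if s = v then if t = u then 1 else 0 else 0)) = (real T)\<^sup>2"
    by (simp add: pull power2_eq_square flip: sum_distrib_left)
  also have "(\<Sum>s<T. \<Sum>t<T. \<Sum>u<T. \<Sum>v<T. (if s = v then if t = v then 1 else 0 else 0)) = (real T)\<^sup>2"
    by (simp add: pull power2_eq_square flip: sum_distrib_left)
  also have "(\<Sum>s<T. \<Sum>t<T. \<Sum>u<T. \<Sum>v<T. (if t = u then if t = v then 1 else 0 else 0)) = (real T)\<^sup>2"
    by (simp add: pull power2_eq_square flip: sum_distrib_left)
  finally show ?thesis by simp
qed

lemma density_rho_avg: "density d (rho_avg T \<rho>)"
proof -
  have avg: "rho_avg T \<rho> = (\<lambda>i j. \<Sum>t<T. of_real (1 / real T) * \<rho> t i j)"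
    by (intro ext) (simp add: rho_avg_def sum_divide_distrib)
  have "psd d (rho_avg T \<rho>)"
    unfolding psd_def
  proof (intro conjI allI)
    have "cnj (\<rho> t j i) = \<rho> t i j" if "t < T" "i < d" "j < d" for t i j
      using hermitian_cnj[OF density_hermitian[OF dens]] that by blast
    then show "hermitian d (rho_avg T \<rho>)"
      by (simp add: hermitian_def rho_avg_def)
  next
    fix v :: "nat \<Rightarrow> complex"
    have "(\<Sum>i<d. \<Sum>j<d. cnj (v i) * rho_avg T \<rho> i j * v j)
        = trace2 d (\<lambda>i j. \<Sum>t<T. of_real (1 / real T) * \<rho> t i j) (\<lambda>j i. cnj (v i) * v j)"
      by (simp add: trace2_def avg mult_ac)
    also have "\<dots> = (\<Sum>t<T. of_real (1 / real T) * cinner d v (mat_vec d (\<rho> t) v))"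
      by (simp only: trace2_sum_left trace2_scale_left) (simp add: trace2_def cinner_mat_vec mult_ac)
    finally show "0 \<le> Re (\<Sum>i<d. \<Sum>j<d. cnj (v i) * rho_avg T \<rho> i j * v j)"
      using psd_cinner[OF density_psd[OF dens]] by (auto intro!: sum_nonneg divide_nonneg_nonneg)
  qed
  moreover have "mat_trace d (rho_avg T \<rho>) = (\<Sum>t<T. mat_trace d (\<rho> t)) / of_nat T"
    by (simp add: mat_trace_def rho_avg_def sum_divide_distrib[symmetric]) (rule disjI2, rule sum.swap)
  ultimately show ?thesis
    using T density_trace[OF dens] by (simp add: density_def)
qed

lemma trace2_rho_avg:
  "(\<Sum>x<T. \<Sum>y<T. Re (trace2 d (\<rho> x) (\<rho> y)))
    = (real T)\<^sup>2 * Re (trace2 d (rho_avg T \<rho>) (rho_avg T \<rho>))"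
  and trace3_rho_avg:
  "(\<Sum>x<T. \<Sum>y<T. \<Sum>z<T. Re (trace3 d (\<rho> x) (\<rho> y) (\<rho> z)))
    = (real T) ^ 3 * Re (trace3 d (rho_avg T \<rho>) (rho_avg T \<rho>) (rho_avg T \<rho>))"
proof -
  define R where "R = (\<lambda>i j. \<Sum>t<T. \<rho> t i j)"
  have R: "R = (\<lambda>i j. of_real (real T) * rho_avg T \<rho> i j)"
    using T by (intro ext) (simp add: R_def rho_avg_def)
  have scale3: "trace3 d A B (\<lambda>i j. c * C i j) = c * trace3 d A B C" for A B C c
    by (simp add: trace3_rotate[of d A] trace3_scale_2)
  have scale2: "trace2 d A (\<lambda>i j. c * C i j) = c * trace2 d A C" for A C c
    by (simp add: trace2_commute[of d A] trace2_scale_left)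
  have "(\<Sum>x<T. \<Sum>y<T. trace2 d (\<rho> x) (\<rho> y)) = trace2 d R R"
    by (simp add: R_def trace2_sum_left trace2_sum_right)
  also have "\<dots> = of_real ((real T)\<^sup>2) * trace2 d (rho_avg T \<rho>) (rho_avg T \<rho>)"
    unfolding R trace2_scale_left scale2 by (simp add: power2_eq_square)
  finally show "(\<Sum>x<T. \<Sum>y<T. Re (trace2 d (\<rho> x) (\<rho> y)))
      = (real T)\<^sup>2 * Re (trace2 d (rho_avg T \<rho>) (rho_avg T \<rho>))"
    by (simp only: Re_sum[symmetric] Re_complex_of_real_mult)
  have "(\<Sum>x<T. \<Sum>y<T. \<Sum>z<T. trace3 d (\<rho> x) (\<rho> y) (\<rho> z)) = trace3 d R R R"
    by (simp add: R_def trace3_sum_1 trace3_sum_2 trace3_sum_3)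
  also have "\<dots> = of_real ((real T) ^ 3) * trace3 d (rho_avg T \<rho>) (rho_avg T \<rho>) (rho_avg T \<rho>)"
    unfolding R trace3_scale_1 trace3_scale_2 scale3 by (simp add: power3_eq_cube)
  finally show "(\<Sum>x<T. \<Sum>y<T. \<Sum>z<T. Re (trace3 d (\<rho> x) (\<rho> y) (\<rho> z)))
      = (real T) ^ 3 * Re (trace3 d (rho_avg T \<rho>) (rho_avg T \<rho>) (rho_avg T \<rho>))"
    by (simp only: Re_sum[symmetric] Re_complex_of_real_mult)
qed

text \<open>For a fixed middle index y the subtracted products sum to (a y)^2. Cauchy-Schwarz over y
  compares the sum of these squares with T^3 (Tr rho_avg^2)^2, which leaves the variance of rho_avg
  in the state rho_avg.\<close>

lemma cov3_sum_le:
  "(\<Sum>y<T. \<Sum>x<T. \<Sum>z<T. cov3 d \<rho> x y z)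
    \<le> (real T) ^ 3 * hs_dist_sq d (rho_avg T \<rho>) (max_mixed d)"
proof -
  let ?A = "rho_avg T \<rho>"
  define a where "a = (\<lambda>y. \<Sum>x<T. Re (trace2 d (\<rho> x) (\<rho> y)))"
  have prod: "(\<Sum>x<T. \<Sum>z<T. Re (trace2 d (\<rho> x) (\<rho> y)) * Re (trace2 d (\<rho> y) (\<rho> z))) = (a y)\<^sup>2" for y
    unfolding a_def power2_eq_square sum_product by (simp only: trace2_commute[of d "\<rho> y"])
  have "(\<Sum>y<T. a y) = (real T)\<^sup>2 * Re (trace2 d ?A ?A)"
    unfolding a_def by (subst sum.swap) (rule trace2_rho_avg)
  \<comment> \<open>Cauchy-Schwarz in the form (sum_y a y)^2 <= T sum_y (a y)^2.\<close>
  then have "((real T)\<^sup>2 * Re (trace2 d ?A ?A))\<^sup>2 \<le> real T * (\<Sum>y<T. (a y)\<^sup>2)"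
    using sum_squared_le_sum_of_squares[of a "{..<T}"] by (simp add: mult.commute)
  then have "real T * (real T ^ 3 * (Re (trace2 d ?A ?A))\<^sup>2) \<le> real T * (\<Sum>y<T. (a y)\<^sup>2)"
    by (simp add: power_mult_distrib power2_eq_square power3_eq_cube mult_ac)
  then have *: "real T ^ 3 * (Re (trace2 d ?A ?A))\<^sup>2 \<le> (\<Sum>y<T. (a y)\<^sup>2)"
    using T by simp
  have "(\<Sum>y<T. \<Sum>x<T. \<Sum>z<T. cov3 d \<rho> x y z)
      = (\<Sum>y<T. \<Sum>x<T. \<Sum>z<T. Re (trace3 d (\<rho> x) (\<rho> y) (\<rho> z))) - (\<Sum>y<T. (a y)\<^sup>2)"
    by (simp add: cov3_def sum_subtractf prod)
  also have "(\<Sum>y<T. \<Sum>x<T. \<Sum>z<T. Re (trace3 d (\<rho> x) (\<rho> y) (\<rho> z)))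
      = (real T) ^ 3 * Re (trace3 d ?A ?A ?A)"
    by (subst sum.swap) (rule trace3_rho_avg)
  finally have "(\<Sum>y<T. \<Sum>x<T. \<Sum>z<T. cov3 d \<rho> x y z)
      \<le> real T ^ 3 * (Re (trace3 d ?A ?A ?A) - (Re (trace2 d ?A ?A))\<^sup>2)"
    using * by (simp add: right_diff_distrib)
  also have "\<dots> \<le> real T ^ 3 * hs_dist_sq d ?A (max_mixed d)"
    by (intro mult_left_mono hs_dist_max_mixed(3)[OF density_rho_avg]) simp
  finally show ?thesis .
qed

text \<open>The full double sum is T^2 Tr rho_avg^2; the omitted diagonal r = sum_s Tr rho_s^2 lies
  between 0 and T.\<close>

lemma swap_stat_mean:
  shows "Re (trace2 (d ^ T) (swap_stat d T) (tensor_prod d T \<rho>)) \<le> hs_dist_sq d (rho_avg T \<rho>) (max_mixed d) + 1 / real d"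
    and "hs_dist_sq d (rho_avg T \<rho>) (max_mixed d) + 1 / real d - 1 / real T
      \<le> Re (trace2 (d ^ T) (swap_stat d T) (tensor_prod d T \<rho>))"
proof -
  define r where "r = (\<Sum>s<T. Re (trace2 d (\<rho> s) (\<rho> s)))"
  have "0 \<le> r"
    unfolding r_def using dens by (intro sum_nonneg density_trace2_nonneg) auto
  have "r \<le> (\<Sum>s<T. 1)"
    unfolding r_def using dens by (intro sum_mono density_trace2_le_1) auto
  then have "r \<le> real T" by simp
  have "Re (trace2 (d ^ T) (swap_stat d T) (tensor_prod d T \<rho>)) = 1 / (real T)\<^sup>2 * (\<Sum>s<T. \<Sum>t<T. swap2 s t)"
    unfolding swap_stat_def trace2_scale_left trace2_sum_left Re_complex_of_real_mult Re_sum ..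
  also have "(\<Sum>s<T. \<Sum>t<T. swap2 s t)
      = (\<Sum>s<T. \<Sum>t<T. Re (trace2 d (\<rho> s) (\<rho> t)) - (if t = s then Re (trace2 d (\<rho> s) (\<rho> s)) else 0))"
    by (intro sum.cong refl) (auto simp: swap2_eq)
  also have "\<dots> = (real T)\<^sup>2 * Re (trace2 d (rho_avg T \<rho>) (rho_avg T \<rho>)) - r"
    by (simp add: sum_subtractf trace2_rho_avg r_def)
  finally have *: "Re (trace2 (d ^ T) (swap_stat d T) (tensor_prod d T \<rho>))
      = hs_dist_sq d (rho_avg T \<rho>) (max_mixed d) + 1 / real d - r / (real T)\<^sup>2"
    using T hs_dist_max_mixed(1)[OF density_rho_avg] by (simp add: field_simps)
  show "Re (trace2 (d ^ T) (swap_stat d T) (tensor_prod d T \<rho>)) \<le> hs_dist_sq d (rho_avg T \<rho>) (max_mixed d) + 1 / real d"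
    using * \<open>0 \<le> r\<close> by simp
  have "r / (real T)\<^sup>2 \<le> real T / (real T)\<^sup>2"
    using \<open>r \<le> real T\<close> by (intro divide_right_mono) auto
  also have "\<dots> = 1 / real T"
    by (simp add: power2_eq_square)
  finally show "hs_dist_sq d (rho_avg T \<rho>) (max_mixed d) + 1 / real d - 1 / real T
      \<le> Re (trace2 (d ^ T) (swap_stat d T) (tensor_prod d T \<rho>))"
    using * by simp
qed

lemma swap_stat_variance:
  "Re (trace3 (d ^ T) (swap_stat d T) (swap_stat d T) (tensor_prod d T \<rho>))
      - (Re (trace2 (d ^ T) (swap_stat d T) (tensor_prod d T \<rho>)))\<^sup>2
    \<le> 4 * hs_dist_sq d (rho_avg T \<rho>) (max_mixed d) / real T + 60 / (real T)\<^sup>2"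
proof -
  let ?D = "hs_dist_sq d (rho_avg T \<rho>) (max_mixed d)"
  have 1: "Re (trace2 (d ^ T) (swap_stat d T) (tensor_prod d T \<rho>)) = 1 / (real T)\<^sup>2 * (\<Sum>s<T. \<Sum>t<T. swap2 s t)"
    unfolding swap_stat_def trace2_scale_left trace2_sum_left Re_complex_of_real_mult Re_sum ..
  have 2: "Re (trace3 (d ^ T) (swap_stat d T) (swap_stat d T) (tensor_prod d T \<rho>))
      = 1 / (real T)\<^sup>2 * (1 / (real T)\<^sup>2 * (\<Sum>s<T. \<Sum>t<T. \<Sum>u<T. \<Sum>v<T. swap4 s t u v))"
    unfolding swap_stat_def trace3_scale_1 trace3_scale_2 trace3_sum_1 trace3_sum_2
      Re_complex_of_real_mult Re_sum ..
  have 3: "(\<Sum>s<T. \<Sum>t<T. swap2 s t)\<^sup>2 = (\<Sum>s<T. \<Sum>t<T. \<Sum>u<T. \<Sum>v<T. swap2 s t * swap2 u v)"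
    unfolding power2_eq_square by (simp only: sum_distrib_right, simp only: sum_distrib_left)
  have "Re (trace3 (d ^ T) (swap_stat d T) (swap_stat d T) (tensor_prod d T \<rho>))
      - (Re (trace2 (d ^ T) (swap_stat d T) (tensor_prod d T \<rho>)))\<^sup>2
      = 1 / real T ^ 4 * (\<Sum>s<T. \<Sum>t<T. \<Sum>u<T. \<Sum>v<T. swap4 s t u v - swap2 s t * swap2 u v)"
    unfolding 1 2 power_mult_distrib 3 sum_subtractf
    by (simp add: power2_eq_square power4_eq_xxxx right_diff_distrib)
  also have "\<dots> \<le> 1 / real T ^ 4 * (4 * (real T ^ 3 * ?D) + 60 * (real T)\<^sup>2)"
    using swap_covariance_sum_le cov3_sum_le by (intro mult_left_mono) auto
  also have "\<dots> = 4 * ?D / real T + 60 / (real T)\<^sup>2"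
    using T by (simp add: field_simps power2_eq_square power3_eq_cube power4_eq_xxxx)
  finally show ?thesis .
qed

end

section \<open>The tester\<close>

text \<open>Here e is 1/T, and x is the scale of the gap: theta when accepting, D when rejecting. Of
  the allowed 0.01 * 0.004^2 = 1.6 / 10^7 times x^2, the main term takes only 4 / 10^8.\<close>

lemma variance_budget:
  fixes D e x V :: real
  assumes V: "V \<le> 4 * (D * e) + 60 * (e * e)" and "0 \<le> e" "10 ^ 8 * e \<le> x" "0 \<le> D" "D \<le> x"
  shows "V \<le> 0.01 * (0.004 * x)\<^sup>2"
proof -
  define q where "q = x * x"
  have x: "0 \<le> x" "e \<le> x / 100000000" using assms by simp_all
  have "D * e \<le> x * (x / 100000000)"
    using assms x by (intro mult_mono) auto
  then have "D * e \<le> q / 100000000" by (simp add: q_def)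
  moreover have "e * e \<le> x / 100000000 * (x / 100000000)"
    using assms x by (intro mult_mono) auto
  then have "e * e \<le> q / 10000000000000000" by (simp add: q_def)
  moreover have "0 \<le> q" by (simp add: q_def)
  ultimately have "V \<le> q / 6250000" using V by linarith
  also have "\<dots> = 0.01 * (0.004 * x)\<^sup>2" by (simp add: q_def power2_eq_square)
  finally show ?thesis .
qed

theorem theorem7p1:
  shows "\<exists>K::real. K > 0 \<and>
    (\<forall>(d::nat) (\<theta>::real) (T::nat). d \<ge> 1 \<longrightarrow> \<theta> \<ge> 0 \<longrightarrow> real T * \<theta> \<ge> K \<longrightarrow>
      (\<exists>M. effect (d ^ T) M \<and>
        (\<forall>\<rho>s. (\<forall>t<T. density d (\<rho>s t)) \<longrightarrow>
           (hs_dist_sq d (rho_avg T \<rho>s) (max_mixed d) \<le> 0.99 * \<theta> \<longrightarrow>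
              accept_prob (d ^ T) M (tensor_prod d T \<rho>s) \<ge> 0.99) \<and>
           (hs_dist_sq d (rho_avg T \<rho>s) (max_mixed d) > \<theta> \<longrightarrow>
              accept_prob (d ^ T) M (tensor_prod d T \<rho>s) \<le> 0.01))))"
proof (intro exI[of _ "10 ^ 8"] conjI allI impI)
  \<comment> \<open>The constant comes from the demand 4 / K + 60 / K^2 <= 0.01 * 0.004^2, which
    10^8 meets with room to spare. The product form of the hypothesis excludes T = 0 and theta =
    0.\<close>
  fix d T :: nat and \<theta> :: real
  assume "d \<ge> 1" "\<theta> \<ge> 0" and K: "real T * \<theta> \<ge> 10 ^ 8"
  define e where "e = 1 / real T"
  have "d > 0" using \<open>d \<ge> 1\<close> by simp
  have "T > 0" using K by (cases T) auto
  then have e: "0 \<le> e" "10 ^ 8 * e \<le> \<theta>"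
    using K by (simp_all add: e_def field_simps)
  have "\<theta> > 0" using K \<open>\<theta> \<ge> 0\<close> by (cases "\<theta> = 0") auto
  \<comment> \<open>The threshold is the midpoint of 0.99 theta and theta, shifted by the 1/d in the
    mean. Each side has a margin of 0.005 theta; 0.004 remains after allowing for the bias
    1/T.\<close>
  let ?X = "swap_stat d T" and ?c = "0.995 * \<theta> + 1 / real d"
  obtain M where M: "effect (d ^ T) M"
    and low: "\<And>\<omega>. psd (d ^ T) \<omega> \<Longrightarrow> mat_trace (d ^ T) \<omega> = 1 \<Longrightarrow> Re (trace2 (d ^ T) ?X \<omega>) < ?c \<Longrightarrow>
      accept_prob (d ^ T) M \<omega> \<ge> 1 - (Re (trace3 (d ^ T) ?X ?X \<omega>) - (Re (trace2 (d ^ T) ?X \<omega>))\<^sup>2)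
        / (?c - Re (trace2 (d ^ T) ?X \<omega>))\<^sup>2"
    and high: "\<And>\<omega>. psd (d ^ T) \<omega> \<Longrightarrow> mat_trace (d ^ T) \<omega> = 1 \<Longrightarrow> Re (trace2 (d ^ T) ?X \<omega>) > ?c \<Longrightarrow>
      accept_prob (d ^ T) M \<omega> \<le> (Re (trace3 (d ^ T) ?X ?X \<omega>) - (Re (trace2 (d ^ T) ?X \<omega>))\<^sup>2)
        / (?c - Re (trace2 (d ^ T) ?X \<omega>))\<^sup>2"
    using threshold_measurement[OF hermitian_swap_stat, of "d ^ T" d T ?c] by metis
  have main: "(hs_dist_sq d (rho_avg T \<rho>) (max_mixed d) \<le> 0.99 * \<theta> \<longrightarrow>
        accept_prob (d ^ T) M (tensor_prod d T \<rho>) \<ge> 0.99) \<and>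
      (hs_dist_sq d (rho_avg T \<rho>) (max_mixed d) > \<theta> \<longrightarrow>
        accept_prob (d ^ T) M (tensor_prod d T \<rho>) \<le> 0.01)"
    if dens: "\<forall>t<T. density d (\<rho> t)" for \<rho>
  proof -
    have dens': "\<And>t. t < T \<Longrightarrow> density d (\<rho> t)" using dens by simp
    let ?w = "tensor_prod d T \<rho>"
    define D where "D = hs_dist_sq d (rho_avg T \<rho>) (max_mixed d)"
    define m where "m = Re (trace2 (d ^ T) ?X ?w)"
    define V where "V = Re (trace3 (d ^ T) ?X ?X ?w) - m\<^sup>2"
    have w: "psd (d ^ T) ?w" "mat_trace (d ^ T) ?w = 1"
      using psd_tensor_density[OF \<open>d > 0\<close>, of T \<rho>, OF dens']
        mat_trace_tensor_density[OF \<open>d > 0\<close>, of T \<rho>, OF dens'] by simp_all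
    have "D \<ge> 0"
      unfolding D_def
      using hs_dist_max_mixed(2) density_rho_avg[OF \<open>d > 0\<close> \<open>T > 0\<close>, of \<rho>, OF dens'] by simp
    have m: "m \<le> D + 1 / real d" "D + 1 / real d - e \<le> m"
      unfolding D_def m_def e_def
      using swap_stat_mean[OF \<open>d > 0\<close> \<open>T > 0\<close>, of \<rho>, OF dens'] by simp_all
    have V: "V \<le> 4 * (D * e) + 60 * (e * e)"
      using swap_stat_variance[OF \<open>d > 0\<close> \<open>T > 0\<close>, of \<rho>, OF dens']
      by (simp add: V_def m_def D_def e_def power2_eq_square)
    have bound: "V / (?c - m)\<^sup>2 \<le> 0.01" if "0 < x" "x \<le> \<bar>?c - m\<bar>" "V \<le> 0.01 * x\<^sup>2" for x
    proof -
      have "x\<^sup>2 \<le> (?c - m)\<^sup>2"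
        using that by (simp add: abs_le_square_iff[symmetric])
      then have "V \<le> 0.01 * (?c - m)\<^sup>2"
        by (intro order_trans[OF that(3)] mult_left_mono) auto
      moreover have "0 < (?c - m)\<^sup>2" using \<open>x\<^sup>2 \<le> (?c - m)\<^sup>2\<close> \<open>0 < x\<close>
        by (metis less_le_trans zero_less_power)
      ultimately show ?thesis by (simp only: pos_divide_le_eq)
    qed
    show ?thesis
      unfolding D_def[symmetric]
    proof (intro conjI impI)
      assume D: "D \<le> 0.99 * \<theta>"
      have "m < ?c" using m D \<open>\<theta> > 0\<close> by simp
      have "V \<le> 0.01 * (0.004 * \<theta>)\<^sup>2"
        using D \<open>\<theta> > 0\<close> by (intro variance_budget[OF V e(1) e(2) \<open>D \<ge> 0\<close>]) simp
      then have "V / (?c - m)\<^sup>2 \<le> 0.01"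
        using m D \<open>\<theta> > 0\<close> by (intro bound[of "0.004 * \<theta>"]) auto
      then have "1 - 0.01 \<le> 1 - V / (?c - m)\<^sup>2"
        by (rule diff_left_mono)
      also have "\<dots> \<le> accept_prob (d ^ T) M ?w"
        using low[OF w] \<open>m < ?c\<close> unfolding m_def V_def by blast
      finally show "0.99 \<le> accept_prob (d ^ T) M ?w" by simp
    next
      assume D: "D > \<theta>"
      \<comment> \<open>As m >= D + 1/d - 1/T and theta < D, the distance to the threshold is at
        least a fixed fraction of D, not merely of theta. This absorbs the variance term 4 D / T
        however large D is.\<close>
      have gap: "0.004 * D \<le> m - ?c" using m D e \<open>\<theta> > 0\<close> by simp
      then have "m > ?c" using D \<open>\<theta> > 0\<close> by simp
      have VD: "V \<le> 0.01 * (0.004 * D)\<^sup>2"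
        using D e(2) by (intro variance_budget[OF V e(1) _ \<open>D \<ge> 0\<close>]) simp_all
      have "accept_prob (d ^ T) M ?w \<le> V / (?c - m)\<^sup>2"
        using high[OF w] \<open>m > ?c\<close> unfolding m_def V_def by blast
      also have "\<dots> \<le> 0.01"
        using gap D \<open>\<theta> > 0\<close> VD by (intro bound[of "0.004 * D"]) auto
      finally show "accept_prob (d ^ T) M ?w \<le> 0.01" .
    qed
  qed
  show "\<exists>M. effect (d ^ T) M \<and>
        (\<forall>\<rho>s. (\<forall>t<T. density d (\<rho>s t)) \<longrightarrow>
           (hs_dist_sq d (rho_avg T \<rho>s) (max_mixed d) \<le> 0.99 * \<theta> \<longrightarrow>
              accept_prob (d ^ T) M (tensor_prod d T \<rho>s) \<ge> 0.99) \<and>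
           (hs_dist_sq d (rho_avg T \<rho>s) (max_mixed d) > \<theta> \<longrightarrow>
              accept_prob (d ^ T) M (tensor_prod d T \<rho>s) \<le> 0.01))"
    using M main by blast
qed simp

end
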